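(* Let $(G,\nu)$ be a computably enumerable numbered group. The following conditions are equivalent: (i) $G$ is amenable; (ii) $(G,\nu)$ has computable Reiter functions; (iii) $(G,\nu)$ has subrecursive F\o lner function; (iv) $(G,\nu)$ is $\Sigma$-amenable. Furthermore, $(G,\nu)$ is computably amenable if and only if $G$ is amenable and $(G,\nu)$ is computable.
   Context: Groups are countable and not assumed finitely generated. "Computable" means recursive; finite subsets of $\mathbb{N}$ are identified with their G\"odel numbers, so algorithms may take them as inputs and give them as outputs. In $\frac1n$, $n$ is a positive integer. $\mathbb{Q}^+$ and $\mathbb{R}^+$ denote the non-negative rationals and reals. $X\subset_{fin}Y$ means $X$ is a finite subset of $Y$. Numbered groups. A numbered group is a pair $(G,\nu)$ with $\nu:\mathbb{N}\to G$ surjective. An enumerated group is a group $(\mathbb{N},\star,{}^{-1},1)$ with underlying set $\mathbb{N}$ and neutral element the number $1$. $(G,\nu)$ is a computably enumerable numbered group if $\nu$ is a surjective homomorphism onto $G$ from an enumerated group $(\mathbb{N},\star,{}^{-1},1)$ whose operations $\star$ and ${}^{-1}$ are computable, and the set $\mathsf{Wrd}^=_\nu$ of all pairs $(w(n_1,\ldots,n_s),w'(\ell_1,\ldots,\ell_t))$, where $w(\bar x),w'(\bar y)$ are group words, $n_i,\ell_j\in\mathbb{N}$, and $w(\nu(n_1),\ldots,\nu(n_s))=w'(\nu(\ell_1),\ldots,\nu(\ell_t))$ holds in $G$, is computably enumerable. It is computable if in addition $\mathsf{Wrd}^=_\nu$ is computable (decidable). F\o lner sets. For $n\geq 1$ and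 $D\subset_{fin}G$, a non-empty finite $F\subset G$ is $\frac1n$-F\o lner with respect to $D$ if $\frac{|F\setminus xF|}{|F|}\le\frac1n$ for all $x\in D$; $\mathfrak{F}$\o l$_{G,D}(n)$ denotes the set of all such $F$. $G$ is amenable if it admits a left-invariant mean on $\ell^\infty(G)$ (equivalently $\mathfrak{F}$\o l$_{G,D}(n)\neq\emptyset$ for all $n,D$). $(G,\nu)$ has subrecursive F\o lner function if the function $(n,D)\mapsto\min\{|F| : F\in\mathfrak{F}$\o l$_{G,\nu(D)}(n)\}$, for $n\ge1$ and $D\subset_{fin}\mathbb{N}$, is bounded above by a total computable function with values in $\mathbb{N}$. $(G,\nu)$ is $\Sigma$-amenable if there is an algorithm which for all pairs $(n,D)$, $n\geq 1$, $D\subset_{fin}\mathbb{N}$, finds $F\subset_{fin}\mathbb{N}$ having a subset $F'\subseteq F$ with $\nu(F')\in\mathfrak{F}$\o l$_{G,\nu(D)}(n)$. $(G,\nu)$ is computably amenable if there is an algorithm which for all such pairs $(n,D)$ finds $F\subset_{fin}\mathbb{N}$ with $\nu(F)\in\mathfrak{F}$\o l$_{G,\nu(D)}(n)$ and $|F|=|\nu(F)|$. Reiter functions. For summable $f:\mathbb{N}\to\mathbb{R}^+$ and $g\in G$ let $\nu_{G,1}(f)(g)=\sum\{f(i): i\in\nu^{-1}(g)\}$. For $h:G\to\mathbb{R}$ let ${}_xh(g)=h(x^{-1}g)$. $(G,\nu)$ has computable Reiter functions if there is an algorithm which for every $n\geq 1$ and finite $D\subset\mathbb{N}$ finds a non-zero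 $f:\mathbb{N}\to\mathbb{Q}^+$ with finite support such that for all $x\in D$, $\frac{\|\nu_{G,1}(f)-{}_{\nu(x)}\nu_{G,1}(f)\|_1}{\|\nu_{G,1}(f)\|_1}<\frac1n$. *)

theory Defs
  imports "HOL-Analysis.Analysis" "HOL-Algebra.Coset" "HOL-Library.Nat_Bijection"
    "HOL-Library.Extended_Nat"
begin

text \<open>
  \<^term>\<open>recursive_fn k f\<close>: the total function \<^term>\<open>f\<close> of \<^term>\<open>k\<close> natural arguments, passed as
  a list of length \<^term>\<open>k\<close>, is recursive.  The total recursive functions are presented as the least
  class with the initial functions that is closed under composition, primitive recursion and
  minimization of regular functions.  Values at lists of any other length carry no meaning and are
  never consulted by the clauses below.
\<close>

inductive recursive_fn :: "nat \<Rightarrow> (nat list \<Rightarrow> nat) \<Rightarrow> bool" where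
  rec_zero: "recursive_fn k (\<lambda>xs. 0)"
| rec_suc: "recursive_fn 1 (\<lambda>xs. Suc (hd xs))"
| rec_proj: "i < k \<Longrightarrow> recursive_fn k (\<lambda>xs. xs ! i)"
| rec_comp: "recursive_fn (length gs) f \<Longrightarrow> (\<forall>g\<in>set gs. recursive_fn k g) \<Longrightarrow>
    recursive_fn k (\<lambda>xs. f (map (\<lambda>g. g xs) gs))"
| rec_prim: "recursive_fn k f \<Longrightarrow> recursive_fn (Suc (Suc k)) g \<Longrightarrow>
    recursive_fn (Suc k)
      (\<lambda>xs. rec_nat (f (tl xs)) (\<lambda>n r. g (n # r # tl xs)) (hd xs))"
| rec_mu: "recursive_fn (Suc k) f \<Longrightarrow> (\<forall>xs. length xs = k \<longrightarrow> (\<exists>n. f (n # xs) = 0)) \<Longrightarrow>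
    recursive_fn k (\<lambda>xs. LEAST n. f (n # xs) = 0)"

definition computable1 :: "(nat \<Rightarrow> nat) \<Rightarrow> bool" where
  "computable1 f \<longleftrightarrow> (\<exists>h. recursive_fn 1 h \<and> (\<forall>x. f x = h [x]))"

definition computable2 :: "(nat \<Rightarrow> nat \<Rightarrow> nat) \<Rightarrow> bool" where
  "computable2 f \<longleftrightarrow> (\<exists>h. recursive_fn 2 h \<and> (\<forall>x y. f x y = h [x, y]))"

definition computable_set :: "nat set \<Rightarrow> bool" where
  "computable_set A \<longleftrightarrow> computable1 (\<lambda>x. if x \<in> A then 1 else 0)"

definition ce_set :: "nat set \<Rightarrow> bool" where
  "ce_set A \<longleftrightarrow> A = {} \<or> (\<exists>f. computable1 f \<and> A = range f)"

definition numbered_group :: "('a, 'b) monoid_scheme \<Rightarrow> (nat \<Rightarrow> 'a) \<Rightarrow> bool" where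
  "numbered_group G \<nu> \<longleftrightarrow> group G \<and> range \<nu> = carrier G"

definition enumerated_group :: "nat monoid \<Rightarrow> bool" where
  "enumerated_group N \<longleftrightarrow> group N \<and> carrier N = UNIV \<and> \<one>\<^bsub>N\<^esub> = 1"

text \<open>
  A group word whose variables have been replaced by natural numbers is a list of letters;
  \<^term>\<open>Inl n\<close> is the number \<^term>\<open>n\<close> and \<^term>\<open>Inr n\<close> is its formal inverse.
\<close>

type_synonym num_word = "(nat + nat) list"

fun letter_val :: "('a, 'b) monoid_scheme \<Rightarrow> (nat \<Rightarrow> 'a) \<Rightarrow> nat + nat \<Rightarrow> 'a" where
  "letter_val G \<nu> (Inl n) = \<nu> n"
| "letter_val G \<nu> (Inr n) = inv\<^bsub>G\<^esub> (\<nu> n)"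

definition word_val :: "('a, 'b) monoid_scheme \<Rightarrow> (nat \<Rightarrow> 'a) \<Rightarrow> num_word \<Rightarrow> 'a" where
  "word_val G \<nu> w = foldr (\<lambda>l g. letter_val G \<nu> l \<otimes>\<^bsub>G\<^esub> g) w \<one>\<^bsub>G\<^esub>"

definition Wrd_eq :: "('a, 'b) monoid_scheme \<Rightarrow> (nat \<Rightarrow> 'a) \<Rightarrow> (num_word \<times> num_word) set" where
  "Wrd_eq G \<nu> = {(w, w'). word_val G \<nu> w = word_val G \<nu> w'}"

definition word_code :: "num_word \<Rightarrow> nat" where
  "word_code w = list_encode (map sum_encode w)"

definition word_pair_code :: "num_word \<times> num_word \<Rightarrow> nat" where
  "word_pair_code p = prod_encode (word_code (fst p), word_code (snd p))"

definition ce_numbered_group :: "('a, 'b) monoid_scheme \<Rightarrow> (nat \<Rightarrow> 'a) \<Rightarrow> bool" where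
  "ce_numbered_group G \<nu> \<longleftrightarrow> numbered_group G \<nu> \<and>
     (\<exists>N. enumerated_group N \<and> computable2 (\<lambda>m n. m \<otimes>\<^bsub>N\<^esub> n) \<and> computable1 (\<lambda>n. inv\<^bsub>N\<^esub> n) \<and>
          \<nu> \<in> epi N G) \<and>
     ce_set (word_pair_code ` Wrd_eq G \<nu>)"

definition computable_numbered_group :: "('a, 'b) monoid_scheme \<Rightarrow> (nat \<Rightarrow> 'a) \<Rightarrow> bool" where
  "computable_numbered_group G \<nu> \<longleftrightarrow>
     ce_numbered_group G \<nu> \<and> computable_set (word_pair_code ` Wrd_eq G \<nu>)"

definition translate :: "('a, 'b) monoid_scheme \<Rightarrow> 'a \<Rightarrow> ('a \<Rightarrow> real) \<Rightarrow> 'a \<Rightarrow> real" where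
  "translate G x h = (\<lambda>g. h (inv\<^bsub>G\<^esub> x \<otimes>\<^bsub>G\<^esub> g))"

text \<open>
  Elements of \<^term>\<open>linf G\<close> may take arbitrary values off the carrier.  This is harmless for means:
  by linearity and positivity a mean takes the same value on functions that agree on the carrier.
\<close>

definition linf :: "('a, 'b) monoid_scheme \<Rightarrow> ('a \<Rightarrow> real) set" where
  "linf G = {f. bounded (f ` carrier G)}"

definition is_mean :: "('a, 'b) monoid_scheme \<Rightarrow> (('a \<Rightarrow> real) \<Rightarrow> real) \<Rightarrow> bool" where
  "is_mean G m \<longleftrightarrow>
     (\<forall>f\<in>linf G. \<forall>h\<in>linf G. m (\<lambda>g. f g + h g) = m f + m h) \<and>
     (\<forall>c. \<forall>f\<in>linf G. m (\<lambda>g. c * f g) = c * m f) \<and>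
     (\<forall>f\<in>linf G. (\<forall>g\<in>carrier G. 0 \<le> f g) \<longrightarrow> 0 \<le> m f) \<and>
     m (\<lambda>g. 1) = 1"

definition amenable :: "('a, 'b) monoid_scheme \<Rightarrow> bool" where
  "amenable G \<longleftrightarrow>
     (\<exists>m. is_mean G m \<and> (\<forall>x\<in>carrier G. \<forall>f\<in>linf G. m (translate G x f) = m f))"

definition Foelner :: "('a, 'b) monoid_scheme \<Rightarrow> 'a set \<Rightarrow> nat \<Rightarrow> 'a set set" where
  "Foelner G D n = {F. finite F \<and> F \<noteq> {} \<and> F \<subseteq> carrier G \<and>
     (\<forall>x\<in>D. real (card (F - (x <#\<^bsub>G\<^esub> F))) / real (card F) \<le> 1 / real n)}"

text \<open>The infimum in \<^typ>\<open>enat\<close> is infinite when there are no Foelner sets at all.\<close>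

definition Foelner_fun ::
  "('a, 'b) monoid_scheme \<Rightarrow> (nat \<Rightarrow> 'a) \<Rightarrow> nat \<Rightarrow> nat set \<Rightarrow> enat" where
  "Foelner_fun G \<nu> n D = (INF F\<in>Foelner G (\<nu> ` D) n. enat (card F))"

text \<open>
  Finite sets \<^term>\<open>D\<close> of natural numbers enter and leave algorithms through the bijective coding
  \<^term>\<open>set_encode\<close> and its inverse \<^term>\<open>set_decode\<close>.
\<close>

definition subrecursive_Foelner :: "('a, 'b) monoid_scheme \<Rightarrow> (nat \<Rightarrow> 'a) \<Rightarrow> bool" where
  "subrecursive_Foelner G \<nu> \<longleftrightarrow>
     (\<exists>b. computable2 b \<and>
        (\<forall>n\<ge>1. \<forall>D. finite D \<longrightarrow> Foelner_fun G \<nu> n D \<le> enat (b n (set_encode D))))"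

definition Sigma_amenable :: "('a, 'b) monoid_scheme \<Rightarrow> (nat \<Rightarrow> 'a) \<Rightarrow> bool" where
  "Sigma_amenable G \<nu> \<longleftrightarrow>
     (\<exists>a. computable2 a \<and>
        (\<forall>n\<ge>1. \<forall>D. finite D \<longrightarrow>
           (\<exists>F'. F' \<subseteq> set_decode (a n (set_encode D)) \<and> \<nu> ` F' \<in> Foelner G (\<nu> ` D) n)))"

definition computably_amenable :: "('a, 'b) monoid_scheme \<Rightarrow> (nat \<Rightarrow> 'a) \<Rightarrow> bool" where
  "computably_amenable G \<nu> \<longleftrightarrow>
     (\<exists>a. computable2 a \<and>
        (\<forall>n\<ge>1. \<forall>D. finite D \<longrightarrow>
           (let F = set_decode (a n (set_encode D))
            in \<nu> ` F \<in> Foelner G (\<nu> ` D) n \<and> card F = card (\<nu> ` F))))"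

definition pushforward :: "(nat \<Rightarrow> 'a) \<Rightarrow> (nat \<Rightarrow> real) \<Rightarrow> 'a \<Rightarrow> real" where
  "pushforward \<nu> f g = (\<Sum>\<^sub>\<infinity>i\<in>\<nu> -` {g}. f i)"

definition l1_norm :: "('a, 'b) monoid_scheme \<Rightarrow> ('a \<Rightarrow> real) \<Rightarrow> real" where
  "l1_norm G h = (\<Sum>\<^sub>\<infinity>g\<in>carrier G. \<bar>h g\<bar>)"

definition nonneg_rat_of :: "nat \<Rightarrow> rat" where
  "nonneg_rat_of c = (case prod_decode c of (p, q) \<Rightarrow> of_nat p / of_nat (Suc q))"

text \<open>
  The finitely supported functions from the natural numbers to the non-negative rationals, coded by
  the lists of their values up to some bound on the support.
\<close>

definition fin_fun_of :: "nat \<Rightarrow> nat \<Rightarrow> rat" where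
  "fin_fun_of c i =
     (if i < length (list_decode c) then nonneg_rat_of (list_decode c ! i) else 0)"

lemma range_nonneg_rat_of: "range nonneg_rat_of = {r. 0 \<le> r}"
proof (intro subset_antisym subsetI)
  fix r :: rat assume "r \<in> {r. 0 \<le> r}"
  then have r: "0 \<le> r" by simp
  obtain a b where ab: "quotient_of r = (a, b)" by (cases "quotient_of r")
  have b: "b > 0" by (rule quotient_of_denom_pos[OF ab])
  have req: "r = of_int a / of_int b" by (rule quotient_of_div[OF ab])
  have a: "a \<ge> 0" using r b unfolding req
    by (simp add: zero_le_divide_iff)
  have "Suc (nat b - 1) = nat b" using b by simp
  then have "nonneg_rat_of (prod_encode (nat a, nat b - 1)) = r"
    using a b by (simp add: req nonneg_rat_of_def del: of_nat_Suc)
  then show "r \<in> range nonneg_rat_of" by (rule range_eqI[OF sym])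
qed (auto simp: nonneg_rat_of_def split: prod.split)

lemma range_fin_fun_of: "range fin_fun_of = {f. finite {i. f i \<noteq> 0} \<and> (\<forall>i. 0 \<le> f i)}"
proof (intro subset_antisym subsetI)
  fix f assume "f \<in> range fin_fun_of"
  then obtain c where f: "f = fin_fun_of c" by blast
  have "{i. f i \<noteq> 0} \<subseteq> {..<length (list_decode c)}"
    by (auto simp: f fin_fun_of_def split: if_splits)
  moreover have "0 \<le> nonneg_rat_of n" for n by (simp add: nonneg_rat_of_def split: prod.split)
  ultimately show "f \<in> {f. finite {i. f i \<noteq> 0} \<and> (\<forall>i. 0 \<le> f i)}"
    by (auto simp: f fin_fun_of_def intro: finite_subset)
next
  fix f :: "nat \<Rightarrow> rat" assume "f \<in> {f. finite {i. f i \<noteq> 0} \<and> (\<forall>i. 0 \<le> f i)}"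
  then have fin: "finite {i. f i \<noteq> 0}" and nn: "\<forall>i. f i \<in> range nonneg_rat_of"
    by (auto simp: range_nonneg_rat_of)
  obtain k where k: "\<forall>i. f i \<noteq> 0 \<longrightarrow> i < k"
    using fin unfolding finite_nat_set_iff_bounded by blast
  have "\<forall>i. \<exists>c. f i = nonneg_rat_of c" using nn by (simp add: image_iff)
  then obtain d where d: "\<And>i. f i = nonneg_rat_of (d i)" by (auto dest: choice)
  have "fin_fun_of (list_encode (map d [0..<k])) i = f i" for i
  proof (cases "i < k")
    case True
    then show ?thesis by (simp add: fin_fun_of_def d)
  next
    case False
    then have "f i = 0" using k by blast
    with False show ?thesis by (simp add: fin_fun_of_def)
  qed
  then have "fin_fun_of (list_encode (map d [0..<k])) = f" by (rule ext)
  then show "f \<in> range fin_fun_of" by (rule range_eqI[OF sym])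
qed

definition computable_Reiter :: "('a, 'b) monoid_scheme \<Rightarrow> (nat \<Rightarrow> 'a) \<Rightarrow> bool" where
  "computable_Reiter G \<nu> \<longleftrightarrow>
     (\<exists>a. computable2 a \<and>
        (\<forall>n\<ge>1. \<forall>D. finite D \<longrightarrow>
           (let f = fin_fun_of (a n (set_encode D));
                h = pushforward \<nu> (\<lambda>i. real_of_rat (f i))
            in (\<exists>i. f i \<noteq> 0) \<and>
               (\<forall>x\<in>D. l1_norm G (\<lambda>g. h g - translate G (\<nu> x) h g) / l1_norm G h < 1 / real n))))"

end

theory Submission
  imports Defs
begin

text \<open>
  Everything passes through one kind of finite object. Let \<open>F\<close> be a finite set of numbers. A
  certificate that \<open>F\<close> is almost invariant under \<open>x\<close> is a partial matching of \<open>F\<close> with itself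
  whose pairs \<open>(u, v)\<close> satisfy \<open>\<nu>(x) \<nu>(u) = \<nu>(v)\<close> and which leaves out at most a proportion \<open>1/n\<close>
  of \<open>F\<close>. Equality in \<open>G\<close> is computably enumerable, so the certified sets can be enumerated; if
  \<open>G\<close> is amenable, a Foelner set lifted along \<open>\<nu>\<close> is certified, so the search for a certified set
  always ends (\<open>computable_search_almost_matched\<close>).

  Such a certificate cannot show that \<open>\<nu>\<close> is injective on \<open>F\<close>, since inequality in \<open>G\<close> need not
  be enumerable. It is therefore read as a statement about the multiplicity function
  \<open>g \<mapsto> |F \<inter> \<nu>\<^sup>-\<^sup>1(g)|\<close>: a matched pair removes one unit of mass from both this function and its
  translate, so the two are close in \<open>l\<^sup>1\<close>. Hence the multiplicity function, which is the push-forward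
  of the indicator function of \<open>F\<close>, is a Reiter function (\<open>Reiter_ratio_if_matched\<close>). By the
  layer-cake formula one of its superlevel sets is a Foelner set, and superlevel sets are images of
  subsets of \<open>F\<close> (\<open>Foelner_subset_if_matched\<close>); this gives \<open>\<Sigma>\<close>-amenability. The code of a finite set
  of numbers bounds its cardinality, so \<open>\<Sigma>\<close>-amenability bounds the Foelner function. If
  the word problem is decidable, injectivity of \<open>\<nu>\<close> on \<open>F\<close> can be made part of the search, and then
  \<open>\<nu>(F)\<close> itself is a Foelner set.

  There remain three facts about groups. First, an amenable group has Foelner sets
  (\<open>Foelner_nonempty_if_amenable\<close>): if there were none for some \<open>n\<close> and \<open>D\<close>, then a finite \<open>K\<close> would
  satisfy \<open>|K F| \<ge> 2 |F|\<close> for all finite \<open>F\<close>, Hall's theorem would turn this into two injections of \<open>G\<close>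
  into itself with disjoint images which multiply every element from the left by one of \<open>K\<close>, and an
  invariant mean would give the two disjoint images the total mass \<open>2\<close>. Second, almost invariant densities
  accumulate at an invariant mean by compactness (\<open>amenable_if_densities\<close>).

  Third, computable amenability decides the word problem (\<open>computable_if_computably_amenable\<close>).
  Given \<open>z\<close>, compute \<open>F\<close> such that \<open>\<nu>\<close> is injective on \<open>F\<close> and \<open>\<nu>(F)\<close> is \<open>1/2\<close>-Foelner with respect to
  \<open>\<nu>(z)\<close>. Then \<open>\<nu>(z) \<nu>(F)\<close> meets \<open>\<nu>(F)\<close>, so an enumeration of the equalities of \<open>G\<close> produces
  \<open>u, v \<in> F\<close> with \<open>\<nu>(z) \<nu>(u) = \<nu>(v)\<close>; and \<open>\<nu>(z) = 1\<close> if and only if \<open>u = v\<close>.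
\<close>

section \<open>Recursive functions, decidable and semidecidable relations\<close>

text \<open>
  Being a total recursive function constrains the values at lists of the wrong length as well. This
  notion only looks at lists of length \<open>k\<close> and so is stable under rewriting the body of a function.
\<close>

definition computable_fn :: "nat \<Rightarrow> (nat list \<Rightarrow> nat) \<Rightarrow> bool" where
  "computable_fn k f \<longleftrightarrow> (\<exists>h. recursive_fn k h \<and> (\<forall>xs. length xs = k \<longrightarrow> f xs = h xs))"

lemma computable_fnI: "recursive_fn k h \<Longrightarrow> (\<And>xs. length xs = k \<Longrightarrow> f xs = h xs) \<Longrightarrow> computable_fn k f"
  unfolding computable_fn_def by blast

lemma computable_fn_cong: "computable_fn k f \<Longrightarrow> (\<And>xs. length xs = k \<Longrightarrow> g xs = f xs) \<Longrightarrow> computable_fn k g"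
  unfolding computable_fn_def by metis

text \<open>
  The argument list serves as an environment: an operator that binds a variable puts the value of this
  variable in front of the list. Rules for binding operators therefore state their premise about
  \<open>hd ys\<close> and \<open>tl ys\<close>, which makes them higher-order patterns, and the variables of a nested body come
  out as \<open>hd\<close> applied to iterated \<open>tl\<close>.
\<close>

named_theorems computability_intros

lemma computable_fn_comp:
  assumes f: "computable_fn (length gs) f" and gs: "\<And>g. g \<in> set gs \<Longrightarrow> computable_fn k g"
  shows "computable_fn k (\<lambda>xs. f (map (\<lambda>g. g xs) gs))"
proof -
  obtain h where h: "recursive_fn (length gs) h" "\<forall>xs. length xs = length gs \<longrightarrow> f xs = h xs"
    using f unfolding computable_fn_def by blast
  have "\<forall>g\<in>set gs. \<exists>h. recursive_fn k h \<and> (\<forall>xs. length xs = k \<longrightarrow> g xs = h xs)"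
    using gs unfolding computable_fn_def by blast
  then obtain H where H: "\<forall>g\<in>set gs. recursive_fn k (H g) \<and> (\<forall>xs. length xs = k \<longrightarrow> g xs = H g xs)"
    by metis
  have "recursive_fn k (\<lambda>xs. h (map (\<lambda>g. g xs) (map H gs)))"
    using h(1) H by (intro rec_comp) auto
  then show ?thesis
  proof (rule computable_fnI)
    fix xs :: "nat list" assume "length xs = k"
    then have "map (\<lambda>g. g xs) (map H gs) = map (\<lambda>g. g xs) gs"
      using H by simp
    then show "f (map (\<lambda>g. g xs) gs) = h (map (\<lambda>g. g xs) (map H gs))"
      using h(2) by (metis length_map)
  qed
qed

lemma computable_fn_nth: "i < k \<Longrightarrow> computable_fn k (\<lambda>xs. xs ! i)"
  by (rule computable_fnI[OF rec_proj]) auto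

text \<open>
  Reordering and dropping variables is composition with projections; the weakening rules for
  environments below are instances.
\<close>

lemma computable_fn_rename:
  assumes "computable_fn j f" and "\<And>i. i < j \<Longrightarrow> \<sigma> i < k"
    and "\<And>xs. length xs = k \<Longrightarrow> g xs = f (map (\<lambda>i. xs ! \<sigma> i) [0..<j])"
  shows "computable_fn k g"
proof -
  have "computable_fn k (\<lambda>xs. f (map (\<lambda>g. g xs) (map (\<lambda>i xs. xs ! \<sigma> i) [0..<j])))"
    using assms(1,2) by (intro computable_fn_comp) (auto intro: computable_fn_nth)
  then show ?thesis by (rule computable_fn_cong) (simp add: assms(3) comp_def)
qed

lemma computable_fn_tl:
  assumes "computable_fn k f" shows "computable_fn (Suc k) (\<lambda>xs. f (tl xs))"
  by (rule computable_fn_rename[OF assms, where \<sigma> = Suc])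
     (auto intro!: arg_cong[where f = f] nth_equalityI simp: nth_tl)

lemma computable_fn_subst:
  assumes f: "computable_fn (Suc k) f" and m: "computable_fn k m"
  shows "computable_fn k (\<lambda>xs. f (m xs # xs))"
proof -
  have "computable_fn k (\<lambda>xs. f (map (\<lambda>g. g xs) (m # map (\<lambda>i xs. xs ! i) [0..<k])))"
    using f m by (intro computable_fn_comp) (auto intro: computable_fn_nth)
  then show ?thesis
    by (rule computable_fn_cong) (auto intro!: arg_cong[where f = f] nth_equalityI simp: comp_def)
qed

lemma computable_fn_drop: "i < k \<Longrightarrow> computable_fn k (\<lambda>xs. hd (drop i xs))"
  by (rule computable_fn_cong[OF computable_fn_nth]) (auto simp: hd_drop_conv_nth)

text \<open>
  Eight projections are enough for the most deeply nested relation below, the one that decides the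
  word problem.
\<close>

lemma computable_fn_proj [computability_intros]:
  "0 < k \<Longrightarrow> computable_fn k hd"
  "Suc 0 < k \<Longrightarrow> computable_fn k (\<lambda>xs. hd (tl xs))"
  "Suc (Suc 0) < k \<Longrightarrow> computable_fn k (\<lambda>xs. hd (tl (tl xs)))"
  "Suc (Suc (Suc 0)) < k \<Longrightarrow> computable_fn k (\<lambda>xs. hd (tl (tl (tl xs))))"
  "Suc (Suc (Suc (Suc 0))) < k \<Longrightarrow> computable_fn k (\<lambda>xs. hd (tl (tl (tl (tl xs)))))"
  "Suc (Suc (Suc (Suc (Suc 0)))) < k \<Longrightarrow> computable_fn k (\<lambda>xs. hd (tl (tl (tl (tl (tl xs))))))"
  "Suc (Suc (Suc (Suc (Suc (Suc 0))))) < k \<Longrightarrow> computable_fn k (\<lambda>xs. hd (tl (tl (tl (tl (tl (tl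
      xs)))))))"
  "Suc (Suc (Suc (Suc (Suc (Suc (Suc 0)))))) < k \<Longrightarrow>
     computable_fn k (\<lambda>xs. hd (tl (tl (tl (tl (tl (tl (tl xs))))))))"
  using computable_fn_drop[of "0" k]
    computable_fn_drop[of "Suc (0)" k]
    computable_fn_drop[of "Suc (Suc (0))" k]
    computable_fn_drop[of "Suc (Suc (Suc (0)))" k]
    computable_fn_drop[of "Suc (Suc (Suc (Suc (0))))" k]
    computable_fn_drop[of "Suc (Suc (Suc (Suc (Suc (0)))))" k]
    computable_fn_drop[of "Suc (Suc (Suc (Suc (Suc (Suc (0))))))" k]
    computable_fn_drop[of "Suc (Suc (Suc (Suc (Suc (Suc (Suc (0)))))))" k]
  by (simp_all add: drop_Suc)

lemma computable_fn_Suc [computability_intros]: "computable_fn k a \<Longrightarrow>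
    computable_fn k (\<lambda>xs. Suc (a xs))"
  using computable_fn_comp[of "[a]" "\<lambda>xs. Suc (hd xs)" k] computable_fnI[OF rec_suc] by simp

lemma computable_fn_const [computability_intros]: "computable_fn k (\<lambda>xs. c)"
proof (induction c)
  case 0
  show ?case by (rule computable_fnI[OF rec_zero]) simp
qed (rule computable_fn_Suc)

lemma computable_fn_prim [computability_intros]:
  assumes a: "computable_fn k a"
    and g: "computable_fn (Suc (Suc k)) (\<lambda>ys. g (hd ys) (hd (tl ys)) (tl (tl ys)))"
    and m: "computable_fn k m"
  shows "computable_fn k (\<lambda>xs. rec_nat (a xs) (\<lambda>n r. g n r xs) (m xs))"
proof -
  obtain ha hg where ha: "recursive_fn k ha" "\<And>xs. length xs = k \<Longrightarrow> a xs = ha xs"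
    and hg: "recursive_fn (Suc (Suc k)) hg"
      "\<And>ys. length ys = Suc (Suc k) \<Longrightarrow> g (hd ys) (hd (tl ys)) (tl (tl ys)) = hg ys"
    using a g unfolding computable_fn_def by metis
  have "computable_fn (Suc k) (\<lambda>ys. rec_nat (a (tl ys)) (\<lambda>n r. g n r (tl ys)) (hd ys))"
  proof (rule computable_fnI[OF rec_prim[OF ha(1) hg(1)]])
    fix ys :: "nat list" assume len: "length ys = Suc k"
    have "rec_nat (a (tl ys)) (\<lambda>n r. g n r (tl ys)) j =
      rec_nat (ha (tl ys)) (\<lambda>n r. hg (n # r # tl ys)) j" for j
    proof (induction j)
      case (Suc j)
      then show ?case using hg(2)[of "j # q # tl ys" for q] len by simp
    qed (simp add: ha(2) len)
    then show "rec_nat (a (tl ys)) (\<lambda>n r. g n r (tl ys)) (hd ys) =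
      rec_nat (ha (tl ys)) (\<lambda>n r. hg (n # r # tl ys)) (hd ys)" .
  qed
  from computable_fn_subst[OF this m] show ?thesis by simp
qed

lemma computable_fn_comp1:
  "computable_fn 1 (\<lambda>xs. f (hd xs)) \<Longrightarrow> computable_fn k a \<Longrightarrow> computable_fn k (\<lambda>xs. f (a xs))"
  using computable_fn_comp[of "[a]" "\<lambda>xs. f (hd xs)" k] by simp

lemma computable_fn_comp2:
  "computable_fn 2 (\<lambda>xs. f (hd xs) (hd (tl xs))) \<Longrightarrow> computable_fn k a \<Longrightarrow> computable_fn k b \<Longrightarrow>
      computable_fn k (\<lambda>xs. f (a xs) (b xs))"
  using computable_fn_comp[of "[a, b]" "\<lambda>xs. f (hd xs) (hd (tl xs))" k] by (auto simp: numeral_2_eq_2)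

lemma computable1_iff: "computable1 f \<longleftrightarrow> computable_fn 1 (\<lambda>xs. f (hd xs))"
proof
  assume "computable1 f"
  then obtain h where h: "recursive_fn 1 h" "\<forall>x. f x = h [x]" unfolding computable1_def by blast
  show "computable_fn 1 (\<lambda>xs. f (hd xs))" by (rule computable_fnI[OF h(1)]) (auto simp: h(2)
      length_Suc_conv)
next
  assume "computable_fn 1 (\<lambda>xs. f (hd xs))"
  then obtain h where "recursive_fn 1 h" "\<forall>xs. length xs = 1 \<longrightarrow> f (hd xs) = h xs"
    unfolding computable_fn_def by blast
  then show "computable1 f" unfolding computable1_def
    by (metis length_Cons list.sel(1) list.size(3) One_nat_def)
qed

lemma computable2_iff: "computable2 f \<longleftrightarrow> computable_fn 2 (\<lambda>xs. f (hd xs) (hd (tl xs)))"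
proof
  assume "computable2 f"
  then obtain h where h: "recursive_fn 2 h" "\<forall>x y. f x y = h [x, y]" unfolding computable2_def by
      blast
  show "computable_fn 2 (\<lambda>xs. f (hd xs) (hd (tl xs)))"
    by (rule computable_fnI[OF h(1)]) (auto simp: h(2) length_Suc_conv numeral_2_eq_2)
next
  assume "computable_fn 2 (\<lambda>xs. f (hd xs) (hd (tl xs)))"
  then obtain h where "recursive_fn 2 h" "\<forall>xs. length xs = 2 \<longrightarrow> f (hd xs) (hd (tl xs)) = h xs"
    unfolding computable_fn_def by blast
  then show "computable2 f" unfolding computable2_def
    by (metis length_Cons list.sel(1,3) list.size(3) numeral_2_eq_2)
qed

lemma computable_fn_add [computability_intros]: "computable_fn k a \<Longrightarrow> computable_fn k b \<Longrightarrow>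
    computable_fn k (\<lambda>xs. a xs + b xs)"
proof -
  assume "computable_fn k a" "computable_fn k b"
  then have "computable_fn k (\<lambda>xs. rec_nat (a xs) (\<lambda>n r. Suc r) (b xs))"
      by (intro computability_intros) simp_all
  moreover have "rec_nat x (\<lambda>n r. Suc r) y = x + y" for x y by (induction y) auto
  ultimately show ?thesis by simp
qed

lemma computable_fn_diff [computability_intros]: "computable_fn k a \<Longrightarrow> computable_fn k b \<Longrightarrow>
    computable_fn k (\<lambda>xs. a xs - b xs)"
proof -
  assume ab: "computable_fn k a" "computable_fn k b"
  have "computable_fn j c \<Longrightarrow> computable_fn j (\<lambda>xs. rec_nat 0 (\<lambda>n r. n) (c xs))" for j c
      by (intro computability_intros) simp_all
  moreover have "rec_nat 0 (\<lambda>n r. n) y = y - 1" for y :: nat by (cases y) auto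
  ultimately have pred: "computable_fn j c \<Longrightarrow> computable_fn j (\<lambda>xs. c xs - 1)" for j c by simp
  from ab have "computable_fn k (\<lambda>xs. rec_nat (a xs) (\<lambda>n r. r - 1) (b xs))"
      by (intro computability_intros pred) simp_all
  moreover have "rec_nat x (\<lambda>n r. r - 1) y = x - y" for x y :: nat by (induction y) auto
  ultimately show ?thesis by simp
qed

lemma computable_fn_mult [computability_intros]: "computable_fn k a \<Longrightarrow> computable_fn k b \<Longrightarrow>
    computable_fn k (\<lambda>xs. a xs * b xs)"
proof -
  assume ab: "computable_fn k a" "computable_fn k b"
  have "computable_fn (Suc (Suc k)) (\<lambda>ys. a (tl (tl ys)))" using ab by (intro computable_fn_tl)
  with ab have "computable_fn k (\<lambda>xs. rec_nat 0 (\<lambda>n r. r + a xs) (b xs))"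
      by (intro computability_intros) simp_all
  moreover have "rec_nat 0 (\<lambda>n r. r + x) y = x * y" for x y :: nat by (induction y) auto
  ultimately show ?thesis by simp
qed

lemma computable_fn_pow2 [computability_intros]: "computable_fn k a \<Longrightarrow> computable_fn k (\<lambda>xs. 2 ^ a xs)"
proof -
  assume ab: "computable_fn k a"
  then have "computable_fn k (\<lambda>xs. rec_nat 1 (\<lambda>n r. r + r) (a xs))"
      by (intro computability_intros) simp_all
  moreover have "rec_nat 1 (\<lambda>n r. r + r) y = (2::nat) ^ y" for y :: nat by (induction y) auto
  ultimately show ?thesis by simp
qed

lemma computable_fn_drop2nd:
  assumes "computable_fn (Suc k) f" shows "computable_fn (Suc (Suc k)) (\<lambda>ys. f (hd ys # tl (tl ys)))"
proof (rule computable_fn_rename[OF assms, where \<sigma> = "\<lambda>i. if i = 0 then 0 else Suc i"])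
  fix xs :: "nat list" assume "length xs = Suc (Suc k)"
  then obtain a b ys where xs: "xs = a # b # ys" "length ys = k" by (auto simp: length_Suc_conv)
  have "a # ys = map (\<lambda>i. xs ! (if i = 0 then 0 else Suc i)) [0..<Suc k]"
    by (rule nth_equalityI) (auto simp: xs nth_Cons simp del: upt_Suc split: nat.split)
  then show "f (hd xs # tl (tl xs)) = f (map (\<lambda>i. xs ! (if i = 0 then 0 else Suc i)) [0..<Suc k])"
    using xs by simp
qed simp

lemma computable_fn_sum [computability_intros]:
  assumes b: "computable_fn k b" and f: "computable_fn (Suc k) (\<lambda>ys. f (hd ys) (tl ys))"
  shows "computable_fn k (\<lambda>xs. \<Sum>n<b xs. f n xs)"
proof -
  have "computable_fn (Suc (Suc k)) (\<lambda>ys. f (hd ys) (tl (tl ys)))"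
    using computable_fn_drop2nd[OF f] by simp
  then have "computable_fn k (\<lambda>xs. rec_nat 0 (\<lambda>n r. r + f n xs) (b xs))"
    using b by (intro computability_intros) simp_all
  moreover have "rec_nat 0 (\<lambda>n r. r + f n xs) m = (\<Sum>n<m. f n xs)" for xs m by (induction m) auto
  ultimately show ?thesis by simp
qed

definition decidable :: "nat \<Rightarrow> (nat list \<Rightarrow> bool) \<Rightarrow> bool" where
  "decidable k P \<longleftrightarrow> computable_fn k (\<lambda>xs. of_bool (P xs))"

lemma decidable_cong: "decidable k P \<Longrightarrow> (\<And>xs. length xs = k \<Longrightarrow> Q xs = P xs) \<Longrightarrow> decidable k Q"
  unfolding decidable_def by (erule computable_fn_cong) simp

lemma decidable_eq_0: "computable_fn k f \<Longrightarrow> decidable k (\<lambda>xs. f xs = 0)"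
  unfolding decidable_def
  by (rule computable_fn_cong[OF computable_fn_diff[OF computable_fn_const[of k 1]], of f]) auto

lemma computable_fn_of_bool [computability_intros]: "decidable k P \<Longrightarrow>
    computable_fn k (\<lambda>xs. of_bool (P xs))"
  unfolding decidable_def .

lemma decidable_const [computability_intros]: "decidable k (\<lambda>xs. c)"
  unfolding decidable_def by (rule computable_fn_const)

lemma decidable_not [computability_intros]: "decidable k P \<Longrightarrow> decidable k (\<lambda>xs. \<not> P xs)"
  using decidable_eq_0[of k "\<lambda>xs. of_bool (P xs)"] unfolding decidable_def by simp

lemma decidable_conj [computability_intros]: "decidable k P \<Longrightarrow> decidable k Q \<Longrightarrow>
    decidable k (\<lambda>xs. P xs \<and> Q xs)"
  unfolding decidable_def of_bool_conj by (rule computable_fn_mult)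

lemma decidable_disj [computability_intros]: "decidable k P \<Longrightarrow> decidable k Q \<Longrightarrow>
    decidable k (\<lambda>xs. P xs \<or> Q xs)"
  by (rule decidable_cong[OF decidable_not[OF decidable_conj[OF decidable_not decidable_not]], of
      k P Q]) auto

lemma decidable_imp [computability_intros]: "decidable k P \<Longrightarrow> decidable k Q \<Longrightarrow>
    decidable k (\<lambda>xs. P xs \<longrightarrow> Q xs)"
  by (rule decidable_cong[OF decidable_disj[OF decidable_not], of k P Q]) auto

lemma decidable_le [computability_intros]: "computable_fn k a \<Longrightarrow> computable_fn k b \<Longrightarrow>
    decidable k (\<lambda>xs. a xs \<le> b xs)"
  using decidable_eq_0[OF computable_fn_diff, of k a b] by simp

lemma decidable_eq [computability_intros]: "computable_fn k a \<Longrightarrow> computable_fn k b \<Longrightarrow>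
    decidable k (\<lambda>xs. a xs = b xs)"
  by (rule decidable_cong[OF decidable_conj[OF decidable_le decidable_le], of k a b b a]) auto

lemma decidable_iff [computability_intros]: "decidable k P \<Longrightarrow> decidable k Q \<Longrightarrow>
    decidable k (\<lambda>xs. P xs \<longleftrightarrow> Q xs)"
  by (rule decidable_cong[OF decidable_conj[OF decidable_imp decidable_imp], of k P Q Q P]) auto

lemma decidable_bex [computability_intros]:
  assumes "computable_fn k b" "decidable (Suc k) (\<lambda>ys. P (hd ys) (tl ys))"
  shows "decidable k (\<lambda>xs. \<exists>n<b xs. P n xs)"
proof -
  have "decidable k (\<lambda>xs. \<not> (\<Sum>n<b xs. of_bool (P n xs)) = (0::nat))"
    using assms by (intro computability_intros)
  then show ?thesis by (rule decidable_cong) (auto simp del: sum_of_bool_eq)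
qed

lemma decidable_ball [computability_intros]:
  assumes "computable_fn k b" "decidable (Suc k) (\<lambda>ys. P (hd ys) (tl ys))"
  shows "decidable k (\<lambda>xs. \<forall>n<b xs. P n xs)"
  using decidable_not[OF decidable_bex[OF assms(1) decidable_not[OF assms(2)]]] by simp

lemma computable_fn_Least:
  assumes P: "decidable (Suc k) (\<lambda>ys. P (hd ys) (tl ys))" and ex: "\<And>xs. length xs = k \<Longrightarrow> \<exists>n. P n xs"
  shows "computable_fn k (\<lambda>xs. LEAST n. P n xs)"
proof -
  have "computable_fn (Suc k) (\<lambda>ys. 1 - of_bool (P (hd ys) (tl ys)))"
    using P by (intro computability_intros)
  then obtain h where h: "recursive_fn (Suc k) h"
    "\<And>ys. length ys = Suc k \<Longrightarrow> 1 - of_bool (P (hd ys) (tl ys)) = h ys"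
    unfolding computable_fn_def by blast
  have hP: "h (n # xs) = 0 \<longleftrightarrow> P n xs" if "length xs = k" for n xs
    using h(2)[of "n # xs"] that by (cases "P n xs") auto
  have "recursive_fn k (\<lambda>xs. LEAST n. h (n # xs) = 0)"
    using h(1) ex by (intro rec_mu) (auto simp: hP)
  then show ?thesis by (rule computable_fnI) (simp add: hP)
qed

lemma decidable_rename:
  assumes "decidable j P" and "\<And>i. i < j \<Longrightarrow> \<sigma> i < k"
    and "\<And>xs. length xs = k \<Longrightarrow> Q xs = P (map (\<lambda>i. xs ! \<sigma> i) [0..<j])"
  shows "decidable k Q"
  unfolding decidable_def
  by (rule computable_fn_rename[OF assms(1)[unfolded decidable_def], of \<sigma>]) (simp_all add: assms(2,3))

lemma decidable_comp2:
  "decidable 2 (\<lambda>xs. P (hd xs) (hd (tl xs))) \<Longrightarrow> computable_fn k a \<Longrightarrow> computable_fn k b \<Longrightarrow>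
      decidable k (\<lambda>xs. P (a xs) (b xs))"
  unfolding decidable_def by (rule computable_fn_comp2)

lemma computable_set_iff: "computable_set A \<longleftrightarrow> decidable 1 (\<lambda>xs. hd xs \<in> A)"
  unfolding computable_set_def computable1_iff decidable_def of_bool_def ..

text \<open>
  Semidecidable relations are the projections of decidable ones. The witness comes first in the
  environment, like any other bound variable.
\<close>

definition semidecidable :: "nat \<Rightarrow> (nat list \<Rightarrow> bool) \<Rightarrow> bool" where
  "semidecidable k P \<longleftrightarrow> (\<exists>T. decidable (Suc k) T \<and> (\<forall>xs. length xs = k \<longrightarrow> P xs = (\<exists>s. T (s # xs))))"

lemma semidecidableI: "decidable (Suc k) T \<Longrightarrow> (\<And>xs. length xs = k \<Longrightarrow> P xs = (\<exists>s. T (s # xs))) \<Longrightarrow>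
    semidecidable k P"
  unfolding semidecidable_def by blast

lemma decidable_drop2nd:
  "decidable (Suc k) P \<Longrightarrow> decidable (Suc (Suc k)) (\<lambda>ys. P (hd ys # tl (tl ys)))"
  unfolding decidable_def by (rule computable_fn_drop2nd)

lemma decidable_drop3rd:
  assumes "decidable (Suc (Suc k)) P"
  shows "decidable (Suc (Suc (Suc k))) (\<lambda>ys. P (hd ys # hd (tl ys) # tl (tl (tl ys))))"
proof (rule decidable_rename[OF assms, where \<sigma> = "\<lambda>i. if i < 2 then i else Suc i"])
  fix xs :: "nat list" assume "length xs = Suc (Suc (Suc k))"
  then obtain a b c ys where xs: "xs = a # b # c # ys" "length ys = k" by (auto simp: length_Suc_conv)
  have "a # b # ys = map (\<lambda>i. xs ! (if i < 2 then i else Suc i)) [0..<Suc (Suc k)]"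
    by (rule nth_equalityI) (auto simp: xs nth_Cons simp del: upt_Suc split: nat.split)
  then show "P (hd xs # hd (tl xs) # tl (tl (tl xs))) =
    P (map (\<lambda>i. xs ! (if i < 2 then i else Suc i)) [0..<Suc (Suc k)])"
    using xs by simp
qed simp

lemma semidecidable_if_decidable: "decidable k P \<Longrightarrow> semidecidable k P"
  using computable_fn_tl[of k "\<lambda>xs. of_bool (P xs)"]
      by (intro semidecidableI[of k "\<lambda>ys. P (tl ys)"]) (auto simp: decidable_def)

text \<open>
  Witnesses for the two conjuncts are replaced by a common bound for both of them. Such
  bounds also merge the witnesses in the next two lemmas and avoid any coding of tuples.
\<close>

lemma semidecidable_conj:
  assumes "semidecidable k P" "semidecidable k Q" shows "semidecidable k (\<lambda>xs. P xs \<and> Q xs)"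
proof -
  obtain T U where T: "decidable (Suc k) T" "\<And>xs. length xs = k \<Longrightarrow> P xs = (\<exists>s. T (s # xs))"
    and U: "decidable (Suc k) U" "\<And>xs. length xs = k \<Longrightarrow> Q xs = (\<exists>s. U (s # xs))"
    using assms unfolding semidecidable_def by metis
  show ?thesis
  proof (rule semidecidableI)
    show "decidable (Suc k) (\<lambda>ys. (\<exists>s<hd ys. T (s # tl ys)) \<and> (\<exists>s<hd ys. U (s # tl ys)))"
      using decidable_drop2nd[OF T(1)] decidable_drop2nd[OF U(1)]
          by (intro computability_intros) simp_all
    fix xs :: "nat list" assume l: "length xs = k"
    have "(\<exists>s<Suc (a + b). T (s # xs)) \<and> (\<exists>s<Suc (a + b). U (s # xs))"
        if "T (a # xs)" "U (b # xs)" for a b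
      using that by (metis le_add1 le_add2 le_imp_less_Suc)
    then show "(P xs \<and> Q xs) = (\<exists>s. (\<exists>s'<hd (s # xs). T (s' # tl (s # xs))) \<and>
        (\<exists>s'<hd (s # xs). U (s' # tl (s # xs))))"
      unfolding T(2)[OF l] U(2)[OF l] list.sel by blast
  qed
qed

lemma semidecidable_ex:
  assumes "semidecidable (Suc k) (\<lambda>ys. P (hd ys) (tl ys))" shows "semidecidable k (\<lambda>xs. \<exists>n. P n xs)"
proof -
  obtain T where T: "decidable (Suc (Suc k)) T"
    "\<And>ys. length ys = Suc k \<Longrightarrow> P (hd ys) (tl ys) = (\<exists>s. T (s # ys))"
    using assms unfolding semidecidable_def by metis
  show ?thesis
  proof (rule semidecidableI)
    show "decidable (Suc k) (\<lambda>ys. \<exists>n<hd ys. \<exists>s<hd ys. T (s # n # tl ys))"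
      using decidable_drop3rd[OF T(1)] by (intro computability_intros) simp_all
    fix xs :: "nat list" assume l: "length xs = k"
    have bound: "(\<exists>n<Suc (a + b). \<exists>s<Suc (a + b). T (s # n # xs))" if "T (a # b # xs)" for a b
      using that by (metis le_add1 le_add2 le_imp_less_Suc)
    have P_iff: "P n xs = (\<exists>s. T (s # n # xs))" for n
      using T(2)[of "n # xs"] l by simp
    show "(\<exists>n. P n xs) = (\<exists>s. \<exists>n<hd (s # xs). \<exists>s'<hd (s # xs). T (s' # n # tl (s # xs)))"
      unfolding list.sel P_iff using bound by blast
  qed
qed

text \<open>
  Finitely many witnesses have a common upper bound.
\<close>

lemma semidecidable_ball:
  assumes b: "computable_fn k b" and P: "semidecidable (Suc k) (\<lambda>ys. P (hd ys) (tl ys))"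
  shows "semidecidable k (\<lambda>xs. \<forall>n<b xs. P n xs)"
proof -
  obtain T where T: "decidable (Suc (Suc k)) T"
    "\<And>ys. length ys = Suc k \<Longrightarrow> P (hd ys) (tl ys) = (\<exists>s. T (s # ys))"
    using P unfolding semidecidable_def by metis
  show ?thesis
  proof (rule semidecidableI)
    show "decidable (Suc k) (\<lambda>ys. \<forall>n<b (tl ys). \<exists>s<hd ys. T (s # n # tl ys))"
      using decidable_drop3rd[OF T(1)] b by (intro computability_intros computable_fn_tl[of k b])
          simp_all
    fix xs :: "nat list" assume l: "length xs = k"
    have bound: "\<exists>s. \<forall>n<m. \<exists>s'<s. T (s' # n # xs)" if "\<forall>n<m. \<exists>s. T (s # n # xs)" for m
    proof -
      obtain w where w: "\<forall>n<m. T (w n # n # xs)" using \<open>\<forall>n<m. \<exists>s. T (s # n # xs)\<close> by metis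
      have "w n < Suc (Max (w ` {..<m}))" if "n < m" for n
        using that by (simp add: less_Suc_eq_le)
      with w show ?thesis by metis
    qed
    have P_iff: "P n xs = (\<exists>s. T (s # n # xs))" for n
      using T(2)[of "n # xs"] l by simp
    show "(\<forall>n<b xs. P n xs) = (\<exists>s. \<forall>n<b (tl (s # xs)). \<exists>s'<hd (s # xs). T (s' # n # tl (s # xs)))"
      unfolding list.sel P_iff using bound by blast
  qed
qed

lemma semidecidable_imp:
  assumes "decidable k P" "semidecidable k Q" shows "semidecidable k (\<lambda>xs. P xs \<longrightarrow> Q xs)"
proof -
  have "decidable (Suc k) (\<lambda>ys. P (tl ys))" using assms(1) unfolding decidable_def
      by (rule computable_fn_tl)
  moreover obtain T where "decidable (Suc k) T" "\<And>xs. length xs = k \<Longrightarrow> Q xs = (\<exists>s. T (s # xs))"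
    using assms(2) unfolding semidecidable_def by metis
  ultimately show ?thesis
    by (intro semidecidableI[of k "\<lambda>ys. P (tl ys) \<longrightarrow> T ys"]) (rule decidable_imp, assumption+, simp)
qed

text \<open>
  A semidecidable relation that is total has a recursive choice function. The search first finds a
  bound \<open>s\<close> below which both a value and a witness for it can be found, and then takes the least
  value with a witness below \<open>s\<close>. Minimizing in two stages avoids decoding pairs.
\<close>

theorem semidecidable_uniformization:
  assumes P: "semidecidable (Suc k) (\<lambda>ys. P (hd ys) (tl ys))" and ex: "\<And>xs. length xs = k \<Longrightarrow>
      \<exists>n. P n xs"
  shows "\<exists>f. computable_fn k f \<and> (\<forall>xs. length xs = k \<longrightarrow> P (f xs) xs)"
proof -
  obtain T where T: "decidable (Suc (Suc k)) T"
    "\<And>ys. length ys = Suc k \<Longrightarrow> P (hd ys) (tl ys) = (\<exists>s. T (s # ys))"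
    using P unfolding semidecidable_def by metis
  have T': "P n xs = (\<exists>s. T (s # n # xs))" if "length xs = k" for n xs
    using T(2)[of "n # xs"] that by simp
  define B where "B xs s \<longleftrightarrow> (\<exists>n<s. \<exists>s'<s. T (s' # n # xs))" for xs s
  have exB: "\<exists>s. B xs s" if l: "length xs = k" for xs
  proof -
    obtain n s where "T (s # n # xs)" using ex[OF l] T'[OF l] by blast
    then have "B xs (Suc (n + s))" unfolding B_def by (metis le_add1 le_add2 le_imp_less_Suc)
    then show ?thesis ..
  qed
  define S where "S xs = (LEAST s. B xs s)" for xs
  have BS: "B xs (S xs)" if "length xs = k" for xs
    unfolding S_def by (rule LeastI_ex[OF exB[OF that]])
  have S: "computable_fn k S"
    unfolding S_def B_def using exB decidable_drop3rd[OF T(1)]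
    by (intro computable_fn_Least computability_intros) (simp_all add: B_def)
  define f where "f xs = (LEAST n. \<exists>s<S xs. T (s # n # xs))" for xs
  have ef: "\<exists>n. \<exists>s<S xs. T (s # n # xs)" if "length xs = k" for xs
    using BS[OF that] unfolding B_def by blast
  have "decidable (Suc k) (\<lambda>ys. \<exists>s<S (tl ys). T (s # hd ys # tl ys))"
    by (intro computability_intros computable_fn_tl[OF S] decidable_cong[OF T(1)]) (auto simp:
        length_Suc_conv)
  then have "computable_fn k f"
    unfolding f_def by (rule computable_fn_Least) (rule ef)
  moreover have "P (f xs) xs" if l: "length xs = k" for xs
    using LeastI_ex[OF ef[OF l]] T'[OF l] unfolding f_def by blast
  ultimately show ?thesis by blast
qed

section \<open>Hall's marriage theorem for infinite families of finite sets\<close>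

definition hall_family :: "('i \<Rightarrow> 'b set) \<Rightarrow> bool" where
  "hall_family S \<longleftrightarrow> (\<forall>i. finite (S i)) \<and> (\<forall>J. finite J \<longrightarrow> card J \<le> card (\<Union>i\<in>J. S i))"

text \<open>
  Hall's condition at a finite index set \<open>J\<close> passes to the intersection of a chain because the members
  of the family are finite: along the chain their total size over \<open>J\<close> attains a minimum, and from
  there on the sets \<open>S i\<close> with \<open>i \<in> J\<close> no longer shrink.
\<close>

lemma hall_family_Inter_chain:
  assumes hall: "\<And>S. S \<in> C \<Longrightarrow> hall_family S" and ne: "C \<noteq> {}"
    and chain: "\<And>S T. S \<in> C \<Longrightarrow> T \<in> C \<Longrightarrow> S \<le> T \<or> T \<le> S"
  shows "hall_family (\<lambda>i. \<Inter>S\<in>C. S i)"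
  unfolding hall_family_def
proof (intro conjI allI impI)
  fix i
  show "finite (\<Inter>S\<in>C. S i)" using hall ne unfolding hall_family_def by blast
next
  fix J :: "'a set" assume J: "finite J"
  have fin: "finite (\<Union>i\<in>J. S i)" if "S \<in> C" for S
    using hall[OF that] J unfolding hall_family_def by blast
  (* a member whose total size over J is least already realises the intersection on J *)
  obtain S where S: "S \<in> C" "\<And>T. T \<in> C \<Longrightarrow> (\<Sum>i\<in>J. card (S i)) \<le> (\<Sum>i\<in>J. card (T i))"
    using ne ex_has_least_nat[of "\<lambda>S. S \<in> C" _ "\<lambda>S. \<Sum>i\<in>J. card (S i)"] by blast
  have "S i = (\<Inter>T\<in>C. T i)" if i: "i \<in> J" for i
  proof -
    have "S i \<subseteq> T i" if T: "T \<in> C" for T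
    proof (rule ccontr)
      assume n: "\<not> S i \<subseteq> T i"
      then have le: "T \<le> S" using chain[OF S(1) T] by (auto simp: le_fun_def)
      then have "T i \<subset> S i" using n by (auto simp: le_fun_def)
      then have "card (T i) < card (S i)"
        using hall[OF S(1)] by (auto simp: hall_family_def intro: psubset_card_mono)
      moreover have "card (T j) \<le> card (S j)" for j
        using hall[OF S(1)] le by (auto simp: hall_family_def le_fun_def intro: card_mono)
      ultimately have "(\<Sum>i\<in>J. card (T i)) < (\<Sum>i\<in>J. card (S i))"
        using J i by (intro sum_strict_mono_ex1) auto
      then show False using S(2)[OF T] by simp
    qed
    then show ?thesis using S(1) by blast
  qed
  then have "(\<Union>i\<in>J. \<Inter>S\<in>C. S i) = (\<Union>i\<in>J. S i)" by simp
  then show "card J \<le> card (\<Union>i\<in>J. \<Inter>S\<in>C. S i)"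
    using hall[OF S(1)] J unfolding hall_family_def by simp
qed

text \<open>
  Zorn's lemma, applied to the reversed pointwise order of families.
\<close>

lemma minimal_hall_family_exists:
  assumes "hall_family S"
  shows "\<exists>T\<le>S. hall_family T \<and> (\<forall>U\<le>T. hall_family U \<longrightarrow> U = T)"
proof -
  let ?A = "{T. hall_family T \<and> T \<le> S}"
  have "\<exists>m\<in>?A. \<forall>a\<in>?A. m \<ge> a \<longrightarrow> a = m"
  proof (rule predicate_Zorn[where P = "\<lambda>x y. y \<le> x"])
    show "partial_order_on ?A (relation_of (\<lambda>x y. y \<le> x) ?A)"
      by (rule partial_order_on_relation_ofI) auto
    fix C assume "C \<in> Chains (relation_of (\<lambda>x y. y \<le> x) ?A)"
    then have C: "C \<subseteq> ?A" and chain: "\<And>S T. S \<in> C \<Longrightarrow> T \<in> C \<Longrightarrow> S \<le> T \<or> T \<le> S"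
      by (auto simp: Chains_def relation_of_def)
    show "\<exists>u\<in>?A. \<forall>a\<in>C. u \<le> a"
    proof (cases "C = {}")
      case False
      with C chain have "hall_family (\<lambda>i. \<Inter>S\<in>C. S i)" by (intro hall_family_Inter_chain) auto
      moreover have le: "(\<lambda>i. \<Inter>S\<in>C. S i) \<le> T" if "T \<in> C" for T
        using that by (auto simp: le_fun_def)
      moreover have "(\<lambda>i. \<Inter>S\<in>C. S i) \<le> S" using False C le by (blast intro: order_trans)
      ultimately show ?thesis by blast
    qed (use assms in auto)
  qed
  then show ?thesis by (auto intro: order_trans)
qed

text \<open>
  Rado's argument. If \<open>S i\<close> had two elements, deleting either of them would violate Hall's condition,
  say at \<open>J \<union> {i}\<close> and at \<open>L \<union> {i}\<close>. Inclusion-exclusion for the two unions then contradicts Hall's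
  condition at \<open>J \<union> L \<union> {i}\<close> and \<open>J \<inter> L\<close>.
\<close>

lemma minimal_hall_family_singleton:
  assumes S: "hall_family S" and minimal: "\<And>T. T \<le> S \<Longrightarrow> hall_family T \<Longrightarrow> T = S"
  shows "\<exists>x. S i = {x}"
proof (rule ccontr)
  assume not1: "\<nexists>x. S i = {x}"
  have fin: "finite (S j)" for j using S unfolding hall_family_def by blast
  have hall: "card J \<le> card (\<Union>j\<in>J. S j)" if "finite J" for J
    using S that unfolding hall_family_def by blast
  have "card {i} \<le> card (S i)" using hall[of "{i}"] by simp
  then have "S i \<noteq> {}" by auto
  with not1 obtain x y where xy: "x \<in> S i" "y \<in> S i" "x \<noteq> y" by blast
  (* deleting one element from S i destroys Hall's condition at a finite set of further indices *)
  have bad: "\<exists>J. finite J \<and> i \<notin> J \<and> card ((\<Union>j\<in>J. S j) \<union> (S i - {z})) \<le> card J"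
    if z: "z \<in> S i" for z
  proof -
    let ?T = "S(i := S i - {z})"
    have "?T \<noteq> S" using z by (auto simp: fun_eq_iff)
    moreover have "?T \<le> S" by (auto simp: le_fun_def)
    ultimately have "\<not> hall_family ?T" using minimal[of ?T] by blast
    moreover have "finite (?T j)" for j using fin by simp
    ultimately obtain J where J: "finite J" "card (\<Union>j\<in>J. ?T j) < card J"
      unfolding hall_family_def not_all not_imp not_le de_Morgan_conj by blast
    have iJ: "i \<in> J"
    proof (rule ccontr)
      assume "i \<notin> J"
      then have "(\<Union>j\<in>J. ?T j) = (\<Union>j\<in>J. S j)" by (auto split: if_splits)
      then show False using J hall[of J] by simp
    qed
    then have "(\<Union>j\<in>J. ?T j) = (\<Union>j\<in>J - {i}. S j) \<union> (S i - {z})" by (auto split: if_splits)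
    then have "card ((\<Union>j\<in>J - {i}. S j) \<union> (S i - {z})) \<le> card (J - {i})"
      using J iJ by (simp add: card_Diff_singleton)
    then show ?thesis using J by (intro exI[of _ "J - {i}"]) auto
  qed
  obtain J where J: "finite J" "i \<notin> J" "card ((\<Union>j\<in>J. S j) \<union> (S i - {x})) \<le> card J"
    using bad[OF xy(1)] by blast
  obtain L where L: "finite L" "i \<notin> L" "card ((\<Union>j\<in>L. S j) \<union> (S i - {y})) \<le> card L"
    using bad[OF xy(2)] by blast
  let ?A = "(\<Union>j\<in>J. S j) \<union> (S i - {x})" and ?B = "(\<Union>j\<in>L. S j) \<union> (S i - {y})"
  have finAB: "finite ?A" "finite ?B" using fin J L by auto
  have "card (insert i (J \<union> L)) \<le> card (\<Union>j\<in>insert i (J \<union> L). S j)"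
    using J L by (intro hall) auto
  also have "(\<Union>j\<in>insert i (J \<union> L). S j) = ?A \<union> ?B" using xy by auto
  finally have un: "Suc (card (J \<union> L)) \<le> card (?A \<union> ?B)" using J L by simp
  have "card (J \<inter> L) \<le> card (\<Union>j\<in>J \<inter> L. S j)" using J by (intro hall) auto
  also have "\<dots> \<le> card (?A \<inter> ?B)" using finAB by (intro card_mono) auto
  finally have int: "card (J \<inter> L) \<le> card (?A \<inter> ?B)" .
  have "card ?A + card ?B = card (?A \<union> ?B) + card (?A \<inter> ?B)" using finAB by (rule card_Un_Int)
  moreover have "card J + card L = card (J \<union> L) + card (J \<inter> L)" using J L by (intro card_Un_Int)
  ultimately show False using un int J(3) L(3) by linarith
qed

theorem hall_injection:
  assumes "hall_family S"
  shows "\<exists>s. inj s \<and> (\<forall>i. s i \<in> S i)"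
proof -
  obtain T where T: "T \<le> S" "hall_family T" "\<And>U. U \<le> T \<Longrightarrow> hall_family U \<Longrightarrow> U = T"
    using minimal_hall_family_exists[OF assms] by blast
  have "\<forall>i. \<exists>x. T i = {x}" using minimal_hall_family_singleton[OF T(2,3)] by blast
  then obtain s where s: "\<And>i. T i = {s i}" by metis
  have "inj s"
  proof (rule injI, rule ccontr)
    fix i j assume "s i = s j" "i \<noteq> j"
    then show False using T(2) s unfolding hall_family_def by (auto dest: spec[of _ "{i, j}"])
  qed
  then show ?thesis using T(1) s by (auto simp: le_fun_def)
qed

text \<open>
  Indices outside \<open>I\<close> receive private values of their own in a sum type, so the version
      for all indices
  applies.
\<close>

corollary hall_injection_on:
  assumes fin: "\<And>i. i \<in> I \<Longrightarrow> finite (S i)"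
    and hall: "\<And>J. finite J \<Longrightarrow> J \<subseteq> I \<Longrightarrow> card J \<le> card (\<Union>i\<in>J. S i)"
  shows "\<exists>s. inj_on s I \<and> (\<forall>i\<in>I. s i \<in> S i)"
proof -
  let ?T = "\<lambda>i. if i \<in> I then Inl ` S i else {Inr i}"
  have "hall_family ?T"
    unfolding hall_family_def
  proof (intro conjI allI impI)
    show "finite (?T i)" for i using fin by simp
    fix J :: "'a set" assume J: "finite J"
    have un: "(\<Union>i\<in>J. ?T i) = (\<Union>i\<in>J \<inter> I. S i) <+> (J - I)"
      by (auto split: if_splits)
    have "card J = card (J \<inter> I) + card (J - I)"
      using J by (metis card_Int_Diff)
    also have "\<dots> \<le> card (\<Union>i\<in>J \<inter> I. S i) + card (J - I)"
      using hall[of "J \<inter> I"] J by simp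
    also have "\<dots> = card (\<Union>i\<in>J. ?T i)"
      unfolding un using J fin by (intro card_Plus[symmetric]) auto
    finally show "card J \<le> card (\<Union>i\<in>J. ?T i)" .
  qed
  then obtain s where s: "inj s" "\<And>i. s i \<in> ?T i"
    using hall_injection by blast
  have "\<exists>y. y \<in> S i \<and> s i = Inl y" if "i \<in> I" for i
    using s(2)[of i] that by auto
  then obtain t where t: "\<And>i. i \<in> I \<Longrightarrow> t i \<in> S i \<and> s i = Inl (t i)" by metis
  have "inj_on t I"
  proof (rule inj_onI)
    fix i j assume "i \<in> I" "j \<in> I" "t i = t j"
    then have "s i = s j" by (simp add: t)
    then show "i = j" by (rule injD[OF s(1)])
  qed
  with t show ?thesis by blast
qed

section \<open>Invariant means force Foelner sets\<close>

lemma card_l_coset: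
  assumes "group G" "x \<in> carrier G" "F \<subseteq> carrier G"
  shows "card (x <#\<^bsub>G\<^esub> F) = card F"
proof -
  interpret group G by fact
  have "inj_on (\<lambda>h. x \<otimes>\<^bsub>G\<^esub> h) F" using assms by (auto simp: inj_on_def subset_iff)
  moreover have "x <#\<^bsub>G\<^esub> F = (\<lambda>h. x \<otimes>\<^bsub>G\<^esub> h) ` F" by (auto simp: l_coset_def)
  ultimately show ?thesis by (simp add: card_image)
qed

lemma finite_l_coset: "finite F \<Longrightarrow> finite (x <#\<^bsub>G\<^esub> F)"
  by (simp add: l_coset_def)

lemma finite_set_mult: "finite K \<Longrightarrow> finite F \<Longrightarrow> finite (K <#>\<^bsub>G\<^esub> F)"
  by (simp add: set_mult_def)

text \<open>
  Left translation preserves cardinality, so \<open>F - x F\<close> and \<open>x F - F\<close> have the same size; the elements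
  of \<open>x F - F\<close> are new in the product set.
\<close>

lemma expansion_if_no_Foelner:
  assumes G: "group G" and D: "finite D" "D \<subseteq> carrier G" and n: "1 \<le> n"
    and empty: "Foelner G D n = {}" and F: "finite F" "F \<subseteq> carrier G"
  shows "(n + 1) * card F \<le> n * card (insert \<one>\<^bsub>G\<^esub> D <#>\<^bsub>G\<^esub> F)"
proof (cases "F = {}")
  case False
  interpret group G by fact
  have "F \<notin> Foelner G D n" using empty by simp
  then obtain x where x: "x \<in> D" "real (card (F - (x <#\<^bsub>G\<^esub> F))) / real (card F) > 1 / real n"
    using F False unfolding Foelner_def by (auto simp: not_le)
  let ?X = "x <#\<^bsub>G\<^esub> F"
  have pos: "card F > 0" using F False by auto
  have "real (card F) < real n * real (card (F - ?X))"
    using x(2) n pos by (simp add: field_simps)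
  then have lt: "card F < n * card (F - ?X)"
    by (metis of_nat_less_iff of_nat_mult)
  have finX: "finite ?X" using F by (intro finite_l_coset)
  have "card (F - ?X) = card F - card (F \<inter> ?X)" using F by (simp add: card_Diff_subset_Int)
  also have "card F = card ?X" using card_l_coset[OF G] x D F by auto
  also have "card ?X - card (F \<inter> ?X) = card (?X - F)"
    using F finX by (simp add: card_Diff_subset_Int Int_commute)
  finally have eq: "card (F - ?X) = card (?X - F)" .
  have "F \<union> (?X - F) \<subseteq> insert \<one>\<^bsub>G\<^esub> D <#>\<^bsub>G\<^esub> F"
    using x F by (force simp: set_mult_def l_coset_def)
  then have "card (F \<union> (?X - F)) \<le> card (insert \<one>\<^bsub>G\<^esub> D <#>\<^bsub>G\<^esub> F)"
    using D F by (intro card_mono finite_set_mult) auto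
  moreover have "card (F \<union> (?X - F)) = card F + card (?X - F)"
    using F finX by (intro card_Un_disjoint) auto
  ultimately have "n * (card F + card (F - ?X)) \<le> n * card (insert \<one>\<^bsub>G\<^esub> D <#>\<^bsub>G\<^esub> F)"
    using eq by simp
  then show ?thesis using lt by (simp add: algebra_simps)
qed simp

text \<open>
  Iterating the expansion \<open>n\<close> times multiplies the size by at least \<open>(1 + 1/n)\<^sup>n\<close>.
\<close>

lemma doubling_if_no_Foelner:
  assumes G: "group G" and D: "finite D" "D \<subseteq> carrier G" and n: "1 \<le> n"
    and empty: "Foelner G D n = {}"
  shows "\<exists>K. finite K \<and> K \<subseteq> carrier G \<and>
    (\<forall>F. finite F \<longrightarrow> F \<subseteq> carrier G \<longrightarrow> 2 * card F \<le> card (K <#>\<^bsub>G\<^esub> F))"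
proof -
  interpret group G by fact
  have iterate: "\<exists>K. finite K \<and> K \<subseteq> carrier G \<and>
    (\<forall>F. finite F \<longrightarrow> F \<subseteq> carrier G \<longrightarrow> (n + 1) ^ r * card F \<le> n ^ r * card (K <#>\<^bsub>G\<^esub> F))" for r
  proof (induction r)
    case 0
    have "{\<one>\<^bsub>G\<^esub>} <#>\<^bsub>G\<^esub> F = F" if "F \<subseteq> carrier G" for F
      using that by (force simp: set_mult_def)
    then show ?case by (intro exI[of _ "{\<one>\<^bsub>G\<^esub>}"]) auto
  next
    case (Suc r)
    let ?E = "insert \<one>\<^bsub>G\<^esub> D"
    obtain K where K: "finite K" "K \<subseteq> carrier G" and
      exp: "\<And>F. finite F \<Longrightarrow> F \<subseteq> carrier G \<Longrightarrow> (n + 1) ^ r * card F \<le> n ^ r * card (K <#>\<^bsub>G\<^esub> F)"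
      using Suc.IH by blast
    have "(n + 1) ^ Suc r * card F \<le> n ^ Suc r * card ((?E <#>\<^bsub>G\<^esub> K) <#>\<^bsub>G\<^esub> F)"
      if F: "finite F" "F \<subseteq> carrier G" for F
    proof -
      have KF: "finite (K <#>\<^bsub>G\<^esub> F)" "K <#>\<^bsub>G\<^esub> F \<subseteq> carrier G"
        using K F by (auto intro: finite_set_mult simp: set_mult_def)
      have "(n + 1) ^ Suc r * card F = (n + 1) * ((n + 1) ^ r * card F)"
          by (simp only: power_Suc mult.assoc)
      also have "\<dots> \<le> (n + 1) * (n ^ r * card (K <#>\<^bsub>G\<^esub> F))"
        by (rule mult_le_mono2[OF exp[OF F]])
      also have "\<dots> = n ^ r * ((n + 1) * card (K <#>\<^bsub>G\<^esub> F))" by (simp only: mult.left_commute)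
      also have "\<dots> \<le> n ^ r * (n * card (?E <#>\<^bsub>G\<^esub> (K <#>\<^bsub>G\<^esub> F)))"
        by (rule mult_le_mono2[OF expansion_if_no_Foelner[OF G D n empty KF]])
      also have "?E <#>\<^bsub>G\<^esub> (K <#>\<^bsub>G\<^esub> F) = (?E <#>\<^bsub>G\<^esub> K) <#>\<^bsub>G\<^esub> F"
        using D K F by (intro set_mult_assoc[symmetric]) auto
      finally show ?thesis by (simp add: mult.assoc mult.left_commute)
    qed
    moreover have "finite (?E <#>\<^bsub>G\<^esub> K)" "?E <#>\<^bsub>G\<^esub> K \<subseteq> carrier G"
      using D K by (auto intro: finite_set_mult simp: set_mult_def)
    ultimately show ?case by blast
  qed
  obtain K where K: "finite K" "K \<subseteq> carrier G" and
    exp: "\<And>F. finite F \<Longrightarrow> F \<subseteq> carrier G \<Longrightarrow> (n + 1) ^ n * card F \<le> n ^ n * card (K <#>\<^bsub>G\<^esub> F)"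
    using iterate[of n] by blast
  (* Bernoulli's inequality: (1 + 1/n)^n is at least 2 *)
  have "1 + real n * (1 / real n) \<le> (1 + 1 / real n) ^ n"
    by (rule Bernoulli_inequality) (use n in \<open>auto simp: field_simps\<close>)
  also have "1 + 1 / real n = real (n + 1) / real n"
    using n by (simp add: field_simps)
  also have "(real (n + 1) / real n) ^ n = real (n + 1) ^ n / real n ^ n"
    by (rule power_divide)
  finally have "2 * real n ^ n \<le> real (n + 1) ^ n"
    using n by (simp add: pos_le_divide_eq)
  then have "real (2 * n ^ n) \<le> real ((n + 1) ^ n)" by simp
  then have bern: "2 * n ^ n \<le> (n + 1) ^ n" by (simp only: of_nat_le_iff)
  have "2 * card F \<le> card (K <#>\<^bsub>G\<^esub> F)" if F: "finite F" "F \<subseteq> carrier G" for F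
  proof -
    have "n ^ n * (2 * card F) \<le> (n + 1) ^ n * card F" using mult_le_mono1[OF bern, of "card F"]
        by (simp add: ac_simps)
    also note exp[OF F]
    finally show ?thesis using n by simp
  qed
  with K show ?thesis by blast
qed

lemma linfI: "(\<And>g. g \<in> carrier G \<Longrightarrow> \<bar>f g\<bar> \<le> B) \<Longrightarrow> f \<in> linf G"
  unfolding linf_def bounded_iff by auto

lemma linf_add: "f \<in> linf G \<Longrightarrow> h \<in> linf G \<Longrightarrow> (\<lambda>g. f g + h g) \<in> linf G"
  unfolding linf_def by (simp add: bounded_plus_comp)

lemma linf_uminus: "f \<in> linf G \<Longrightarrow> (\<lambda>g. -1 * f g) \<in> linf G"
  unfolding linf_def by (simp add: bounded_minus_comp)

lemma mean_add:
  "is_mean G m \<Longrightarrow> f \<in> linf G \<Longrightarrow> h \<in> linf G \<Longrightarrow> m (\<lambda>g. f g + h g) = m f + m h"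
  unfolding is_mean_def by blast

lemma mean_scale: "is_mean G m \<Longrightarrow> f \<in> linf G \<Longrightarrow> m (\<lambda>g. c * f g) = c * m f"
  unfolding is_mean_def by blast

lemma mean_one: "is_mean G m \<Longrightarrow> m (\<lambda>g. 1) = 1"
  unfolding is_mean_def by blast

lemma mean_nonneg:
  "is_mean G m \<Longrightarrow> f \<in> linf G \<Longrightarrow> (\<And>g. g \<in> carrier G \<Longrightarrow> 0 \<le> f g) \<Longrightarrow> 0 \<le> m f"
  unfolding is_mean_def by blast

lemma mean_sum:
  assumes m: "is_mean G m" and fin: "finite A" and f: "\<And>i. i \<in> A \<Longrightarrow> f i \<in> linf G"
  shows "(\<lambda>g. \<Sum>i\<in>A. f i g) \<in> linf G \<and> m (\<lambda>g. \<Sum>i\<in>A. f i g) = (\<Sum>i\<in>A. m (f i))"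
  using fin f
proof (induction A rule: finite_induct)
  case empty
  have "(\<lambda>g. 0::real) \<in> linf G" by (rule linfI[of _ _ 0]) simp
  with mean_scale[OF m this, of 0] show ?case by simp
next
  case (insert i A)
  then have IH: "(\<lambda>g. \<Sum>i\<in>A. f i g) \<in> linf G" "m (\<lambda>g. \<Sum>i\<in>A. f i g) = (\<Sum>i\<in>A. m (f i))"
    and fi: "f i \<in> linf G" by simp_all
  show ?case
    using linf_add[OF fi IH(1)] mean_add[OF m fi IH(1)] IH(2) insert.hyps by simp
qed

lemma mean_mono:
  assumes m: "is_mean G m" and f: "f \<in> linf G" and h: "h \<in> linf G"
    and le: "\<And>g. g \<in> carrier G \<Longrightarrow> f g \<le> h g"
  shows "m f \<le> m h"
proof -
  note neg = linf_uminus[OF f]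
  have "0 \<le> m (\<lambda>g. h g + (-1 * f g))"
    by (rule mean_nonneg[OF m linf_add[OF h neg]]) (simp add: le)
  also have "\<dots> = m h + -1 * m f"
    unfolding mean_add[OF m h neg] mean_scale[OF m f] ..
  finally show ?thesis by simp
qed

lemma of_bool_in_linf: "(\<lambda>g. of_bool (P g) :: real) \<in> linf G"
  by (rule linfI[of _ _ 1]) simp

lemma one_in_linf: "(\<lambda>g. 1 :: real) \<in> linf G"
  using of_bool_in_linf[of "\<lambda>_. True"] by simp

text \<open>
  Doubling is Hall's condition for the family that offers \<open>K g\<close> to each of two copies of \<open>g\<close>. The
  resulting injection \<open>s\<close> maps \<open>(g, b)\<close> to \<open>k g\<close> for some \<open>k \<in> K\<close>. For each \<open>b\<close>, the sets of those \<open>g\<close>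
  which use the multiplier \<open>k\<close> partition the group, so their means add up to \<open>2\<close>
  over both values of \<open>b\<close>. Their translates by \<open>k\<close> lie in the image of \<open>s\<close> and are disjoint
      because \<open>s\<close>
  is injective, so the means of the translates add up to at most \<open>1\<close>.
\<close>

lemma not_amenable_if_doubling:
  assumes G: "group G" and K: "finite K" "K \<subseteq> carrier G"
    and doubling: "\<And>F. finite F \<Longrightarrow> F \<subseteq> carrier G \<Longrightarrow> 2 * card F \<le> card (K <#>\<^bsub>G\<^esub> F)"
  shows "\<not> amenable G"
proof
  interpret group G by fact
  assume "amenable G"
  then obtain m where m: "is_mean G m"
    and inv: "\<And>x f. x \<in> carrier G \<Longrightarrow> f \<in> linf G \<Longrightarrow> m (translate G x f) = m f"
    unfolding amenable_def by blast
  let ?I = "carrier G \<times> (UNIV :: bool set)"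
  have "\<exists>s. inj_on s ?I \<and> (\<forall>i\<in>?I. s i \<in> K <#>\<^bsub>G\<^esub> {fst i})"
  proof (rule hall_injection_on)
    fix J assume J: "finite J" "J \<subseteq> ?I"
    have "J \<subseteq> fst ` J \<times> (UNIV :: bool set)" by (rule subsetI) (simp add: mem_Times_iff)
    then have "card J \<le> card (fst ` J \<times> (UNIV :: bool set))"
      using J by (intro card_mono finite_SigmaI finite_imageI) simp_all
    also have "\<dots> = 2 * card (fst ` J)" by (simp add: card_cartesian_product)
    also have "\<dots> \<le> card (K <#>\<^bsub>G\<^esub> (fst ` J))"
    proof (rule doubling)
      show "finite (fst ` J)" using J(1) by (rule finite_imageI)
      show "fst ` J \<subseteq> carrier G" using J(2) by fastforce
    qed
    also have "K <#>\<^bsub>G\<^esub> (fst ` J) = (\<Union>i\<in>J. K <#>\<^bsub>G\<^esub> {fst i})" by (auto simp: set_mult_def)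
    finally show "card J \<le> card (\<Union>i\<in>J. K <#>\<^bsub>G\<^esub> {fst i})" .
  qed (rule finite_set_mult[OF K(1)], simp)
  then obtain s where s: "inj_on s ?I" "\<And>g b. g \<in> carrier G \<Longrightarrow> s (g, b) \<in> K <#>\<^bsub>G\<^esub> {g}"
    by fastforce
  (* the indicator function of the set of those g whose copy (fst p) uses the multiplier (snd p) *)
  define \<phi> :: "bool \<times> 'a \<Rightarrow> 'a \<Rightarrow> real" where
    "\<phi> p g = of_bool (s (g, fst p) = snd p \<otimes>\<^bsub>G\<^esub> g)" for p g
  have lin: "\<phi> p \<in> linf G" "translate G x (\<phi> p) \<in> linf G" for p x
    unfolding \<phi>_def translate_def by (rule of_bool_in_linf)+
  let ?P = "(UNIV :: bool set) \<times> K"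
  have finP: "finite ?P" using K by simp
  have piece: "(\<Sum>p\<in>?P. \<phi> p g) = 2" if g: "g \<in> carrier G" for g
  proof -
    have "(\<Sum>k\<in>K. \<phi> (b, k) g) = 1" for b
    proof -
      obtain k where k: "k \<in> K" "s (g, b) = k \<otimes>\<^bsub>G\<^esub> g" using s(2)[OF g, of b]
          by (auto simp: set_mult_def)
      have "\<phi> (b, k') g = of_bool (k' = k)" if "k' \<in> K" for k'
        using k g K that by (auto simp: \<phi>_def subset_iff)
      then have "(\<Sum>k\<in>K. \<phi> (b, k) g) = (\<Sum>k'\<in>K. of_bool (k' = k))" by simp
      also have "\<dots> = 1" using k K by (simp add: of_bool_def)
      finally show ?thesis .
    qed
    then have "(\<Sum>b\<in>UNIV. \<Sum>k\<in>K. \<phi> (b, k) g) = 2" by (simp add: UNIV_bool)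
    then show ?thesis by (simp add: sum.cartesian_product)
  qed
  have packed: "(\<Sum>p\<in>?P. translate G (snd p) (\<phi> p) g) \<le> 1" if g: "g \<in> carrier G" for g
  proof -
    let ?Q = "{p\<in>?P. s (inv\<^bsub>G\<^esub> (snd p) \<otimes>\<^bsub>G\<^esub> g, fst p) = g}"
    have cancel: "k \<otimes>\<^bsub>G\<^esub> (inv\<^bsub>G\<^esub> k \<otimes>\<^bsub>G\<^esub> g) = g" if "k \<in> K" for k
    proof -
      have "k \<in> carrier G" using that K by blast
      then show ?thesis using m_assoc[of k "inv\<^bsub>G\<^esub> k" g] g by simp
    qed
    have "(\<Sum>p\<in>?P. translate G (snd p) (\<phi> p) g) = (\<Sum>p\<in>?P.
        if s (inv\<^bsub>G\<^esub> (snd p) \<otimes>\<^bsub>G\<^esub> g, fst p) = g then 1 else 0)"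
      by (intro sum.cong refl) (auto simp: translate_def \<phi>_def cancel)
    also have "\<dots> = (\<Sum>p\<in>?Q. 1)" by (rule sum.inter_filter[OF finP, symmetric])
    also have "\<dots> = real (card ?Q)" by simp
    also have "card ?Q \<le> 1"
    proof -
      have unique: "p = q" if p: "p \<in> ?Q" and q: "q \<in> ?Q" for p q
      proof -
        have c: "snd p \<in> carrier G" "snd q \<in> carrier G" using p q K by auto
        then have "(inv\<^bsub>G\<^esub> (snd p) \<otimes>\<^bsub>G\<^esub> g, fst p) = (inv\<^bsub>G\<^esub> (snd q) \<otimes>\<^bsub>G\<^esub> g, fst q)"
          using p q g by (intro inj_onD[OF s(1)]) auto
        then have eq: "fst p = fst q" "inv\<^bsub>G\<^esub> (snd p) \<otimes>\<^bsub>G\<^esub> g = inv\<^bsub>G\<^esub> (snd q) \<otimes>\<^bsub>G\<^esub> g"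
          by simp_all
        then have "inv\<^bsub>G\<^esub> (snd p) = inv\<^bsub>G\<^esub> (snd q)"
          using c g by (simp add: right_cancel)
        then have "snd p = snd q" using c by (metis inv_inv)
        with eq show ?thesis by (simp add: prod_eq_iff)
      qed
      have "finite ?Q" using finP by simp
      then show ?thesis unfolding One_nat_def
        by (subst card_le_Suc0_iff_eq, assumption) (intro ballI unique)
    qed
    finally show ?thesis by simp
  qed
  note \<phi>_sum = mean_sum[OF m finP, of \<phi>, OF lin(1)]
  note translate_sum = mean_sum[OF m finP, of "\<lambda>p. translate G (snd p) (\<phi> p)", OF lin(2)]
  have "2 = m (\<lambda>g. 1) + m (\<lambda>g. 1)" by (simp add: mean_one[OF m])
  also have "\<dots> = m (\<lambda>g. 1 + 1)" by (rule mean_add[OF m one_in_linf one_in_linf, symmetric])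
  also have "\<dots> \<le> m (\<lambda>g. \<Sum>p\<in>?P. \<phi> p g)"
  proof (rule mean_mono[OF m])
    show "(\<lambda>g. 1 + 1 :: real) \<in> linf G"
      by (rule linf_add[OF one_in_linf one_in_linf])
    show "(\<lambda>g. \<Sum>p\<in>?P. \<phi> p g) \<in> linf G" by (rule \<phi>_sum[THEN conjunct1])
  qed (simp add: piece)
  also have "\<dots> = (\<Sum>p\<in>?P. m (\<phi> p))" by (rule \<phi>_sum[THEN conjunct2])
  also have "\<dots> = (\<Sum>p\<in>?P. m (translate G (snd p) (\<phi> p)))"
  proof (rule sum.cong[OF refl], rule inv[symmetric])
    show "snd p \<in> carrier G" if "p \<in> ?P" for p using that K by auto
  qed (rule lin(1))
  also have "\<dots> = m (\<lambda>g. \<Sum>p\<in>?P. translate G (snd p) (\<phi> p) g)"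
    by (rule translate_sum[THEN conjunct2, symmetric])
  also have "\<dots> \<le> m (\<lambda>g. 1)"
    by (rule mean_mono[OF m translate_sum[THEN conjunct1] one_in_linf packed])
  also have "\<dots> = 1" by (rule mean_one[OF m])
  finally show False by simp
qed

theorem Foelner_nonempty_if_amenable:
  assumes "group G" "amenable G" "finite D" "D \<subseteq> carrier G" "1 \<le> n"
  shows "Foelner G D n \<noteq> {}"
proof
  assume "Foelner G D n = {}"
  from doubling_if_no_Foelner[OF assms(1,3,4,5) this] obtain K where K: "finite K" "K \<subseteq> carrier G"
    "\<And>F. finite F \<Longrightarrow> F \<subseteq> carrier G \<Longrightarrow> 2 * card F \<le> card (K <#>\<^bsub>G\<^esub> F)"
    by blast
  from not_amenable_if_doubling[OF assms(1) this] assms(2) show False by blast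
qed

section \<open>From almost invariant densities to an invariant mean\<close>

lemma l1_norm_eq_sum:
  assumes "finite T" "T \<subseteq> carrier G" "\<And>g. g \<in> carrier G \<Longrightarrow> g \<notin> T \<Longrightarrow> h g = 0"
  shows "l1_norm G h = (\<Sum>g\<in>T. \<bar>h g\<bar>)"
proof -
  have "(\<Sum>\<^sub>\<infinity>g\<in>carrier G. \<bar>h g\<bar>) = (\<Sum>\<^sub>\<infinity>g\<in>T. \<bar>h g\<bar>)"
    using assms by (intro infsum_cong_neutral) auto
  then show ?thesis using assms(1) by (simp add: l1_norm_def)
qed

text \<open>
  Tychonoff's theorem for a product of intervals. The cluster point inherits every closed condition
  that eventually holds along the sequence, and all defining properties of an invariant mean are
  expressed by such conditions.
\<close>

lemma cluster_point_of_bounded_functions: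
  fixes M :: "nat \<Rightarrow> 'i \<Rightarrow> real"
  assumes bound: "\<And>n i. \<bar>M n i\<bar> \<le> B i"
  shows "\<exists>m. \<forall>C. closed C \<longrightarrow> (\<forall>\<^sub>F n in sequentially. M n \<in> C) \<longrightarrow> m \<in> C"
proof -
  let ?K = "PiE UNIV (\<lambda>i. {- B i .. B i})"
  have "compactin (product_topology (\<lambda>i. euclidean) UNIV) ?K"
    by (simp add: compactin_PiE)
  then have compact: "compact ?K"
    by (simp add: euclidean_product_topology)
  let ?F = "filtermap M sequentially"
  have "M n \<in> ?K" for n
    using bound[of n] by (auto simp: PiE_iff abs_le_iff minus_le_iff)
  then have "eventually (\<lambda>x. x \<in> ?K) ?F"
    by (simp add: eventually_filtermap)
  moreover have "?F \<noteq> bot" by (simp add: filtermap_bot_iff)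
  ultimately obtain m where m: "inf (nhds m) ?F \<noteq> bot"
    using compact unfolding compact_filter by blast
  have "m \<in> C" if C: "closed C" "\<forall>\<^sub>F n in sequentially. M n \<in> C" for C
  proof (rule ccontr)
    assume "m \<notin> C"
    then have "eventually (\<lambda>x. x \<in> - C) (nhds m)"
      using C(1) by (intro eventually_nhds_in_open) auto
    moreover have "eventually (\<lambda>x. x \<in> C) ?F"
      using C(2) by (simp add: eventually_filtermap)
    ultimately have "eventually (\<lambda>x. False) (inf (nhds m) ?F)"
      unfolding eventually_inf by (intro exI[of _ "\<lambda>x. x \<in> - C"] exI[of _ "\<lambda>x. x \<in> C"]) auto
    then show False using m by (simp add: trivial_limit_def)
  qed
  then show ?thesis by blast
qed

lemma linf_bound: "f \<in> linf G \<Longrightarrow> \<exists>B. 0 \<le> B \<and> (\<forall>g\<in>carrier G. \<bar>f g\<bar> \<le> B)"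
  unfolding linf_def bounded_pos by (auto intro: less_imp_le)

lemma linf_translate:
  assumes "group G" "x \<in> carrier G" "f \<in> linf G" shows "translate G x f \<in> linf G"
proof -
  interpret group G by fact
  have "translate G x f ` carrier G \<subseteq> f ` carrier G"
    using assms by (auto simp: translate_def)
  then show ?thesis using assms(3) unfolding linf_def by (auto intro: bounded_subset)
qed

lemma linf_scale: "f \<in> linf G \<Longrightarrow> (\<lambda>g. c * f g) \<in> linf G"
  using bounded_scaleR_comp[of f "carrier G" c] unfolding linf_def by simp

text \<open>
  Substituting \<open>x g\<close> for \<open>g\<close> moves the translation from \<open>f\<close> to \<open>h\<close>, where it becomes a translation by
  the inverse of \<open>x\<close>.
\<close>

lemma sum_translate_diff_le:
  assumes G: "group G" and x: "x \<in> carrier G"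
    and S: "finite S" "S \<subseteq> carrier G" and supp: "\<And>g. g \<notin> S \<Longrightarrow> h g = 0"
    and B: "\<And>g. g \<in> carrier G \<Longrightarrow> \<bar>f g\<bar> \<le> B"
  shows "\<bar>(\<Sum>g\<in>S. translate G x f g * h g) - (\<Sum>g\<in>S. f g * h g)\<bar>
    \<le> B * l1_norm G (\<lambda>g. h g - translate G (inv\<^bsub>G\<^esub> x) h g)"
proof -
  interpret group G by fact
  let ?y = "inv\<^bsub>G\<^esub> x"
  let ?S' = "(\<lambda>g. ?y \<otimes>\<^bsub>G\<^esub> g) ` S"
  let ?T = "S \<union> ?S'"
  have T: "finite ?T" "?T \<subseteq> carrier G" using S x by auto
  have tr: "translate G ?y h g = h (x \<otimes>\<^bsub>G\<^esub> g)" for g using x by (simp add: translate_def)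
  have supp': "h (x \<otimes>\<^bsub>G\<^esub> g) = 0" if g: "g \<in> carrier G" "g \<notin> ?S'" for g
  proof (rule supp, rule)
    assume "x \<otimes>\<^bsub>G\<^esub> g \<in> S"
    then have "?y \<otimes>\<^bsub>G\<^esub> (x \<otimes>\<^bsub>G\<^esub> g) \<in> ?S'" by blast
    moreover have "?y \<otimes>\<^bsub>G\<^esub> (x \<otimes>\<^bsub>G\<^esub> g) = g" using x g(1) by (simp add: m_assoc[symmetric])
    ultimately show False using g(2) by simp
  qed
  have "inj_on (\<lambda>g. ?y \<otimes>\<^bsub>G\<^esub> g) S" using S x by (auto simp: inj_on_def subset_iff)
  then have "(\<Sum>g\<in>?S'. f g * h (x \<otimes>\<^bsub>G\<^esub> g)) =
      (\<Sum>g\<in>S. f (?y \<otimes>\<^bsub>G\<^esub> g) * h (x \<otimes>\<^bsub>G\<^esub> (?y \<otimes>\<^bsub>G\<^esub> g)))"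
    by (simp add: sum.reindex)
  also have "\<dots> = (\<Sum>g\<in>S. translate G x f g * h g)"
  proof (rule sum.cong[OF refl])
    fix g assume "g \<in> S"
    then have "x \<otimes>\<^bsub>G\<^esub> (?y \<otimes>\<^bsub>G\<^esub> g) = g" using x S m_assoc[of x ?y g] by auto
    then show "f (?y \<otimes>\<^bsub>G\<^esub> g) * h (x \<otimes>\<^bsub>G\<^esub> (?y \<otimes>\<^bsub>G\<^esub> g)) = translate G x f g * h g"
      by (simp add: translate_def)
  qed
  finally have "(\<Sum>g\<in>S. translate G x f g * h g) = (\<Sum>g\<in>?S'. f g * h (x \<otimes>\<^bsub>G\<^esub> g))" by simp
  also have "\<dots> = (\<Sum>g\<in>?T. f g * h (x \<otimes>\<^bsub>G\<^esub> g))"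
    using S T supp' by (intro sum.mono_neutral_left) auto
  finally have "(\<Sum>g\<in>S. translate G x f g * h g) = (\<Sum>g\<in>?T. f g * h (x \<otimes>\<^bsub>G\<^esub> g))" .
  moreover have "(\<Sum>g\<in>S. f g * h g) = (\<Sum>g\<in>?T. f g * h g)"
    using T supp by (intro sum.mono_neutral_left) auto
  ultimately have "(\<Sum>g\<in>S. translate G x f g * h g) - (\<Sum>g\<in>S. f g * h g) =
      (\<Sum>g\<in>?T. f g * (h (x \<otimes>\<^bsub>G\<^esub> g) - h g))"
    by (simp add: sum_subtractf right_diff_distrib)
  also have "\<bar>\<dots>\<bar> \<le> (\<Sum>g\<in>?T. \<bar>f g * (h (x \<otimes>\<^bsub>G\<^esub> g) - h g)\<bar>)" by (rule sum_abs)
  also have "\<dots> \<le> (\<Sum>g\<in>?T. B * \<bar>h g - translate G ?y h g\<bar>)"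
  proof (rule sum_mono)
    fix g assume "g \<in> ?T"
    then have "\<bar>f g\<bar> \<le> B" using B T by blast
    then show "\<bar>f g * (h (x \<otimes>\<^bsub>G\<^esub> g) - h g)\<bar> \<le> B * \<bar>h g - translate G ?y h g\<bar>"
      by (simp add: tr abs_mult abs_minus_commute mult_right_mono)
  qed
  also have "\<dots> = B * l1_norm G (\<lambda>g. h g - translate G ?y h g)"
    using T supp supp' by (subst l1_norm_eq_sum[of ?T]) (auto simp: sum_distrib_left tr)
  finally show ?thesis .
qed

text \<open>
  The means are the weighted averages with weights \<open>h n\<close>; a cluster point of them is an invariant
      mean.
  On unbounded functions the averages are set to \<open>0\<close>, so that all of them lie in one product of
  intervals.
\<close>

theorem amenable_if_densities:
  fixes h :: "nat \<Rightarrow> 'a \<Rightarrow> real"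
  assumes G: "group G"
    and S: "\<And>n. finite (S n)" "\<And>n. S n \<subseteq> carrier G"
    and supp: "\<And>n g. g \<notin> S n \<Longrightarrow> h n g = 0" and nonneg: "\<And>n g. 0 \<le> h n g"
    and nonzero: "\<And>n. \<exists>g. h n g \<noteq> 0"
    and lim: "\<And>x. x \<in> carrier G \<Longrightarrow>
      (\<lambda>n. l1_norm G (\<lambda>g. h n g - translate G x (h n) g) / l1_norm G (h n)) \<longlonglongrightarrow> 0"
  shows "amenable G"
proof -
  interpret group G by fact
  define L where "L n = (\<Sum>g\<in>S n. h n g)" for n
  have L_norm: "l1_norm G (h n) = L n" for n
    using S supp nonneg by (subst l1_norm_eq_sum[of "S n"]) (auto simp: L_def)
  have L_pos: "L n > 0" for n
  proof -
    obtain g where "h n g \<noteq> 0" using nonzero by blast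
    then have "g \<in> S n" "h n g > 0" using supp nonneg[of n g] by (auto simp: less_le)
    then show ?thesis unfolding L_def using S(1) nonneg by (intro sum_pos2) auto
  qed
  define M where "M n f = (if f \<in> linf G then (\<Sum>g\<in>S n. f g * h n g) / L n else 0)" for n f
  have "\<exists>B. \<forall>f. f \<in> linf G \<longrightarrow> 0 \<le> B f \<and> (\<forall>g\<in>carrier G. \<bar>f g\<bar> \<le> B f)"
    using linf_bound by (intro choice) blast
  then obtain B where B: "\<And>f. f \<in> linf G \<Longrightarrow> 0 \<le> B f"
    "\<And>f g. f \<in> linf G \<Longrightarrow> g \<in> carrier G \<Longrightarrow> \<bar>f g\<bar> \<le> B f" by blast
  have M_bound: "\<bar>M n f\<bar> \<le> (if f \<in> linf G then B f else 0)" for n f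
  proof (cases "f \<in> linf G")
    case True
    have "\<bar>\<Sum>g\<in>S n. f g * h n g\<bar> \<le> (\<Sum>g\<in>S n. \<bar>f g * h n g\<bar>)" by (rule sum_abs)
    also have "\<dots> \<le> (\<Sum>g\<in>S n. B f * h n g)"
    proof (rule sum_mono)
      fix g assume "g \<in> S n"
      then have "\<bar>f g\<bar> \<le> B f" using B(2)[OF True] S(2) by blast
      then show "\<bar>f g * h n g\<bar> \<le> B f * h n g" using nonneg by (simp add: abs_mult mult_right_mono)
    qed
    also have "\<dots> = B f * L n" by (simp add: L_def sum_distrib_left)
    finally show ?thesis using True L_pos[of n] by (simp add: M_def pos_divide_le_eq)
  qed (simp add: M_def)
  obtain m where m: "\<And>C. closed C \<Longrightarrow> (\<forall>\<^sub>F n in sequentially. M n \<in> C) \<Longrightarrow> m \<in> C"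
    using cluster_point_of_bounded_functions[of M, OF M_bound] by blast
  have coord: "continuous_on UNIV (\<lambda>m::('a \<Rightarrow> real) \<Rightarrow> real. m f)" for f
    by (rule continuous_on_product_coordinates)
  have add: "m (\<lambda>g. f g + k g) = m f + m k" if "f \<in> linf G" "k \<in> linf G" for f k
  proof -
    have "M n (\<lambda>g. f g + k g) = M n f + M n k" for n
      using that linf_add[OF that] by (simp add: M_def distrib_right sum.distrib add_divide_distrib)
    then have "m \<in> {m. m (\<lambda>g. f g + k g) = m f + m k}"
      by (intro m closed_Collect_eq continuous_intros coord) simp
    then show ?thesis by simp
  qed
  have scale: "m (\<lambda>g. c * f g) = c * m f" if "f \<in> linf G" for c f
  proof -
    have "M n (\<lambda>g. c * f g) = c * M n f" for n
      using that linf_scale[OF that] by (simp add: M_def sum_distrib_left mult.assoc)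
    then have "m \<in> {m. m (\<lambda>g. c * f g) = c * m f}"
      by (intro m closed_Collect_eq continuous_intros coord) simp
    then show ?thesis by simp
  qed
  have pos: "0 \<le> m f" if "f \<in> linf G" "\<And>g. g \<in> carrier G \<Longrightarrow> 0 \<le> f g" for f
  proof -
    have "0 \<le> M n f" for n
      using that S(2)[of n] nonneg L_pos[of n]
      by (auto simp: M_def subset_iff intro!: divide_nonneg_pos sum_nonneg mult_nonneg_nonneg)
    then have "m \<in> {m. 0 \<le> m f}"
      by (intro m closed_Collect_le continuous_intros coord) simp
    then show ?thesis by simp
  qed
  have one: "m (\<lambda>g. 1) = 1"
  proof -
    have "M n (\<lambda>g. 1) = 1" for n using L_pos[of n] by (simp add: M_def L_def one_in_linf)
    then have "m \<in> {m. m (\<lambda>g. 1) = 1}"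
      by (intro m closed_Collect_eq continuous_intros coord) simp
    then show ?thesis by simp
  qed
  have inv: "m (translate G x f) = m f" if x: "x \<in> carrier G" and f: "f \<in> linf G" for x f
  proof -
    let ?r = "\<lambda>n. l1_norm G (\<lambda>g. h n g - translate G (inv\<^bsub>G\<^esub> x) (h n) g) / l1_norm G (h n)"
    have le: "\<bar>M n (translate G x f) - M n f\<bar> \<le> B f * ?r n" for n
    proof -
      have "M n (translate G x f) - M n f =
          ((\<Sum>g\<in>S n. translate G x f g * h n g) - (\<Sum>g\<in>S n. f g * h n g)) / L n"
        using f linf_translate[OF G x f] by (simp add: M_def diff_divide_distrib)
      also have "\<bar>\<dots>\<bar> \<le> B f * l1_norm G (\<lambda>g. h n g - translate G (inv\<^bsub>G\<^esub> x) (h n) g) / L n"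
        using sum_translate_diff_le[OF G x S(1)[of n] S(2)[of n] supp B(2)[OF f]] L_pos[of n]
        by (simp add: divide_right_mono)
      finally show ?thesis by (simp add: L_norm)
    qed
    have lim0: "(\<lambda>n. B f * ?r n) \<longlonglongrightarrow> 0"
      using tendsto_mult_right_zero[OF lim[of "inv\<^bsub>G\<^esub> x"], of "B f"] x by simp
    have "\<bar>m (translate G x f) - m f\<bar> \<le> e" if e: "e > 0" for e
    proof -
      have "\<forall>\<^sub>F n in sequentially. B f * ?r n < e" using order_tendstoD(2)[OF lim0 e] .
      then have "\<forall>\<^sub>F n in sequentially. M n \<in> {m. \<bar>m (translate G x f) - m f\<bar> \<le> e}"
        by eventually_elim (use le in \<open>auto intro: order_trans less_imp_le\<close>)
      then have "m \<in> {m. \<bar>m (translate G x f) - m f\<bar> \<le> e}"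
        by (intro m closed_Collect_le continuous_intros coord)
      then show ?thesis by simp
    qed
    then have "\<bar>m (translate G x f) - m f\<bar> \<le> 0" by (rule field_le_epsilon) simp
    then show ?thesis by simp
  qed
  have "is_mean G m" unfolding is_mean_def using add scale pos one by blast
  then show ?thesis unfolding amenable_def using inv by blast
qed

lemma l1_ratio_tendsto_0:
  assumes "\<And>n. j \<le> n \<Longrightarrow> l1_norm G (p n) / l1_norm G (q n) < 1 / real (Suc n)"
  shows "(\<lambda>n. l1_norm G (p n) / l1_norm G (q n)) \<longlonglongrightarrow> 0"
proof (rule tendsto_sandwich[of "\<lambda>n. 0" _ _ "\<lambda>n. 1 / real (Suc n)"])
  have "0 \<le> l1_norm G (p n) / l1_norm G (q n)" for n by (simp add: l1_norm_def infsum_nonneg)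
  then show "\<forall>\<^sub>F n in sequentially. 0 \<le> l1_norm G (p n) / l1_norm G (q n)" by simp
  show "\<forall>\<^sub>F n in sequentially. l1_norm G (p n) / l1_norm G (q n) \<le> 1 / real (Suc n)"
    using eventually_ge_at_top[of j] by eventually_elim (use assms in \<open>auto intro: less_imp_le\<close>)
  show "(\<lambda>n. 1 / real (Suc n)) \<longlonglongrightarrow> 0"
    using LIMSEQ_inverse_real_of_nat by (simp add: inverse_eq_divide)
qed simp

lemma pushforward_eq_sum:
  assumes "finite {i. f i \<noteq> 0}"
  shows "pushforward \<nu> f g = (\<Sum>i | f i \<noteq> 0 \<and> \<nu> i = g. f i)"
proof -
  have "(\<Sum>\<^sub>\<infinity>i\<in>\<nu> -` {g}. f i) = (\<Sum>\<^sub>\<infinity>i\<in>{i. f i \<noteq> 0 \<and> \<nu> i = g}. f i)"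
    by (intro infsum_cong_neutral) auto
  moreover have "finite {i. f i \<noteq> 0 \<and> \<nu> i = g}" using assms by (rule rev_finite_subset) auto
  ultimately show ?thesis by (simp add: pushforward_def)
qed

theorem amenable_if_computable_Reiter:
  fixes G :: "('a, 'b) monoid_scheme"
  assumes num: "numbered_group G \<nu>" and R: "computable_Reiter G \<nu>"
  shows "amenable G"
proof -
  have G: "group G" and \<nu>: "range \<nu> = carrier G" using num unfolding numbered_group_def by auto
  obtain a where a: "\<And>n D. 1 \<le> n \<Longrightarrow> finite D \<Longrightarrow> (let f = fin_fun_of (a n (set_encode D));
      h = pushforward \<nu> (\<lambda>i. real_of_rat (f i))
      in (\<exists>i. f i \<noteq> 0) \<and>
         (\<forall>x\<in>D. l1_norm G (\<lambda>g. h g - translate G (\<nu> x) h g) / l1_norm G h < 1 / real n))"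
    using R unfolding computable_Reiter_def by blast
  define f where "f n = fin_fun_of (a (Suc n) (set_encode {..n}))" for n
  define h where "h n = pushforward \<nu> (\<lambda>i. real_of_rat (f n i))" for n
  have "f n \<in> range fin_fun_of" for n by (simp add: f_def)
  then have fin: "finite {i. f n i \<noteq> 0}" and f_nonneg: "0 \<le> f n i" for n i
    unfolding range_fin_fun_of by auto
  have f_nonzero: "\<exists>i. f n i \<noteq> 0"
    and small: "\<And>x. x \<le> n \<Longrightarrow>
      l1_norm G (\<lambda>g. h n g - translate G (\<nu> x) (h n) g) / l1_norm G (h n) < 1 / real (Suc n)" for n
    using a[of "Suc n" "{..n}"] by (auto simp: Let_def f_def h_def)
  have h_eq: "h n g = (\<Sum>i | f n i \<noteq> 0 \<and> \<nu> i = g. real_of_rat (f n i))" for n g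
    using pushforward_eq_sum[of "\<lambda>i. real_of_rat (f n i)" \<nu> g] fin by (simp add: h_def)
  show ?thesis
  proof (rule amenable_if_densities[OF G, of "\<lambda>n. \<nu> ` {i. f n i \<noteq> 0}" h])
    show "finite (\<nu> ` {i. f n i \<noteq> 0})" for n using fin by simp
    show "\<nu> ` {i. f n i \<noteq> 0} \<subseteq> carrier G" for n using \<nu> by auto
    show "h n g = 0" if "g \<notin> \<nu> ` {i. f n i \<noteq> 0}" for n g
      unfolding h_eq using that by (intro sum.neutral) auto
    show "0 \<le> h n g" for n g unfolding h_eq using f_nonneg by (intro sum_nonneg) simp
    show "\<exists>g. h n g \<noteq> 0" for n
    proof -
      obtain i where i: "f n i \<noteq> 0" using f_nonzero by blast
      then have "f n i > 0" using f_nonneg[of n i] by simp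
      moreover have "finite {j. f n j \<noteq> 0 \<and> \<nu> j = \<nu> i}" using fin[of n]
          by (rule rev_finite_subset) auto
      ultimately have "0 < h n (\<nu> i)"
        unfolding h_eq using f_nonneg i by (intro sum_pos2[of _ i]) auto
      then show ?thesis by (intro exI[of _ "\<nu> i"]) simp
    qed
    fix x assume "x \<in> carrier G"
    then obtain j where j: "x = \<nu> j" using \<nu> by auto
    show "(\<lambda>n. l1_norm G (\<lambda>g. h n g - translate G x (h n) g) / l1_norm G (h n)) \<longlonglongrightarrow> 0"
      by (rule l1_ratio_tendsto_0[of j]) (use small j in auto)
  qed
qed

section \<open>Matchings as certificates of almost invariance\<close>

text \<open>
  The matching \<open>M\<close> may depend on \<open>x\<close>. The inequality says that a proportion of at least \<open>1 - 1/n\<close> of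
  \<open>F\<close> is matched, written without subtraction and division; it is no restriction for \<open>n = 0\<close>, which
  makes the search for such sets total.
\<close>

definition almost_matched :: "('a, 'b) monoid_scheme \<Rightarrow> (nat \<Rightarrow> 'a) \<Rightarrow> nat \<Rightarrow> nat set \<Rightarrow> nat set \<Rightarrow>
    bool" where
  "almost_matched G \<nu> n D F \<longleftrightarrow> finite F \<and> F \<noteq> {} \<and>
     (\<forall>x\<in>D. \<exists>M. M \<subseteq> F \<times> F \<and> inj_on fst M \<and> inj_on snd M \<and>
        (\<forall>(u, v)\<in>M. \<nu> x \<otimes>\<^bsub>G\<^esub> \<nu> u = \<nu> v) \<and> n * card F \<le> n * card M + card F)"

definition multiplicity_in :: "(nat \<Rightarrow> 'a) \<Rightarrow> nat set \<Rightarrow> 'a \<Rightarrow> nat" where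
  "multiplicity_in \<nu> F g = card {i \<in> F. \<nu> i = g}"

lemma multiplicity_in_eq_0: "finite F \<Longrightarrow> multiplicity_in \<nu> F g = 0 \<longleftrightarrow> g \<notin> \<nu> ` F"
  by (auto simp: multiplicity_in_def)

lemma sum_multiplicity_in: "finite F \<Longrightarrow> (\<Sum>g\<in>\<nu> ` F. multiplicity_in \<nu> F g) = card F"
  unfolding multiplicity_in_def
  using card_eq_sum[of F] sum.image_gen[of F "\<lambda>i. 1::nat" \<nu>] by simp

lemma mem_l_coset_iff:
  assumes "group G" "x \<in> carrier G" "g \<in> carrier G" "A \<subseteq> carrier G"
  shows "g \<in> x <#\<^bsub>G\<^esub> A \<longleftrightarrow> inv\<^bsub>G\<^esub> x \<otimes>\<^bsub>G\<^esub> g \<in> A"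
proof -
  interpret group G by fact
  show ?thesis
  proof
    assume "g \<in> x <#\<^bsub>G\<^esub> A"
    then obtain h where "h \<in> A" "g = x \<otimes>\<^bsub>G\<^esub> h" by (auto simp: l_coset_def)
    moreover from this have "h \<in> carrier G" using assms by blast
    ultimately show "inv\<^bsub>G\<^esub> x \<otimes>\<^bsub>G\<^esub> g \<in> A"
      using assms m_assoc[of "inv\<^bsub>G\<^esub> x" x h] by simp
  next
    assume "inv\<^bsub>G\<^esub> x \<otimes>\<^bsub>G\<^esub> g \<in> A"
    moreover have "x \<otimes>\<^bsub>G\<^esub> (inv\<^bsub>G\<^esub> x \<otimes>\<^bsub>G\<^esub> g) = g"
      using assms m_assoc[of x "inv\<^bsub>G\<^esub> x" g] by simp
    ultimately show "g \<in> x <#\<^bsub>G\<^esub> A" unfolding l_coset_def by force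
  qed
qed

text \<open>
  Let \<open>m g\<close> be the number of matched pairs whose second component is a number of \<open>g\<close>. Injectivity
      of both
  projections bounds \<open>m g\<close> by the multiplicity of \<open>g\<close> and by that of its translate, so the excess
      at \<open>g\<close>
  is at most the number of unmatched elements over \<open>g\<close>. Truncated subtraction
  yields the positive part of the difference.
\<close>

lemma excess_le_of_matched:
  assumes num: "numbered_group G \<nu>" and A: "almost_matched G \<nu> n D F" and x: "x \<in> D"
  shows "n * (\<Sum>g\<in>\<nu> ` F. multiplicity_in \<nu> F g - multiplicity_in \<nu> F (inv\<^bsub>G\<^esub> (\<nu> x) \<otimes>\<^bsub>G\<^esub> g)) \<le> card F"
proof -
  interpret group G using num unfolding numbered_group_def by blast
  have \<nu>: "\<nu> i \<in> carrier G" for i using num unfolding numbered_group_def by auto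
  have F: "finite F" using A unfolding almost_matched_def by blast
  obtain M where M: "M \<subseteq> F \<times> F" "inj_on fst M" "inj_on snd M"
    and eq: "\<And>u v. (u, v) \<in> M \<Longrightarrow> \<nu> x \<otimes>\<^bsub>G\<^esub> \<nu> u = \<nu> v"
    and big: "n * card F \<le> n * card M + card F"
    using A x unfolding almost_matched_def by blast
  have finM: "finite M" by (rule finite_subset[OF M(1)]) (use F in simp)
  define m where "m g = card {p \<in> M. \<nu> (snd p) = g}" for g
  have m1: "m g \<le> multiplicity_in \<nu> F g" for g
    unfolding m_def multiplicity_in_def
  proof (rule card_inj_on_le)
    show "inj_on snd {p \<in> M. \<nu> (snd p) = g}" using M(3) by (rule inj_on_subset) auto
  qed (use M(1) F in auto)
  have m2: "m g \<le> multiplicity_in \<nu> F (inv\<^bsub>G\<^esub> (\<nu> x) \<otimes>\<^bsub>G\<^esub> g)" for g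
    unfolding m_def multiplicity_in_def
  proof (rule card_inj_on_le)
    show "inj_on fst {p \<in> M. \<nu> (snd p) = g}" using M(2) by (rule inj_on_subset) auto
    have "\<nu> u = inv\<^bsub>G\<^esub> (\<nu> x) \<otimes>\<^bsub>G\<^esub> \<nu> v" if "(u, v) \<in> M" for u v
      using eq[OF that] \<nu> by (metis inv_solve_left)
    then show "fst ` {p \<in> M. \<nu> (snd p) = g} \<subseteq> {i \<in> F. \<nu> i = inv\<^bsub>G\<^esub> (\<nu> x) \<otimes>\<^bsub>G\<^esub> g}"
      using M(1) by auto
  qed (use F in auto)
  have "(\<Sum>g\<in>\<nu> ` F. m g) = (\<Sum>g\<in>\<nu> ` F. \<Sum>p\<in>{p \<in> M. \<nu> (snd p) = g}. 1)"
    by (simp add: m_def)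
  also have "\<dots> = (\<Sum>p\<in>M. 1)"
    using F finM M(1) by (intro sum.group) auto
  finally have sum_m: "(\<Sum>g\<in>\<nu> ` F. m g) = card M" by simp
  have "(\<Sum>g\<in>\<nu> ` F. multiplicity_in \<nu> F g - multiplicity_in \<nu> F (inv\<^bsub>G\<^esub> (\<nu> x) \<otimes>\<^bsub>G\<^esub> g))
      \<le> (\<Sum>g\<in>\<nu> ` F. multiplicity_in \<nu> F g - m g)"
    using m2 by (intro sum_mono diff_le_mono2)
  also have "\<dots> = card F - card M"
    using sum_subtractf_nat[of "\<nu> ` F" m "multiplicity_in \<nu> F"] m1
    by (simp add: sum_m sum_multiplicity_in[OF F])
  finally have "n * (\<Sum>g\<in>\<nu> ` F. multiplicity_in \<nu> F g - multiplicity_in \<nu> F (inv\<^bsub>G\<^esub> (\<nu> x) \<otimes>\<^bsub>G\<^esub> g))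
      \<le> n * (card F - card M)" by (rule mult_le_mono2)
  also have "\<dots> \<le> card F" using big by (simp add: diff_mult_distrib2)
  finally show ?thesis .
qed

text \<open>
  The lift chooses one number for each element of the Foelner set; the matching is then the graph of
  translation by \<open>\<nu> x\<close>.
\<close>

lemma Foelner_lift_matched:
  assumes num: "numbered_group G \<nu>" and n: "1 \<le> n" and A: "A \<in> Foelner G (\<nu> ` D) n"
  shows "\<exists>F. almost_matched G \<nu> n D F \<and> inj_on \<nu> F"
proof -
  interpret group G using num unfolding numbered_group_def by blast
  have \<nu>: "\<nu> i \<in> carrier G" for i using num unfolding numbered_group_def by auto
  have A': "finite A" "A \<noteq> {}" "A \<subseteq> range \<nu>"
    using A num unfolding Foelner_def numbered_group_def by auto
  obtain F where F: "inj_on \<nu> F" "\<nu> ` F = A" using subset_image_inj[of A \<nu> UNIV] A'(3) by metis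
  have finF: "finite F" using F A'(1) by (metis finite_imageD)
  have "\<exists>M. M \<subseteq> F \<times> F \<and> inj_on fst M \<and> inj_on snd M \<and>
        (\<forall>(u, v)\<in>M. \<nu> x \<otimes>\<^bsub>G\<^esub> \<nu> u = \<nu> v) \<and> n * card F \<le> n * card M + card F" if x: "x \<in> D" for x
  proof -
    let ?X = "\<nu> x <#\<^bsub>G\<^esub> A"
    let ?M = "{(u, v) \<in> F \<times> F. \<nu> x \<otimes>\<^bsub>G\<^esub> \<nu> u = \<nu> v}"
    have "inj_on fst ?M" using F(1) by (auto simp: inj_on_def)
    moreover have inj2: "inj_on snd ?M"
    proof (rule inj_onI, clarsimp)
      fix u u' v assume "u \<in> F" "u' \<in> F" "\<nu> x \<otimes>\<^bsub>G\<^esub> \<nu> u' = \<nu> v" "\<nu> x \<otimes>\<^bsub>G\<^esub> \<nu> u = \<nu> v"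
      then have "\<nu> u = \<nu> u'" using \<nu> by (metis Units_eq Units_l_cancel)
      then show "u = u'" using F(1) \<open>u \<in> F\<close> \<open>u' \<in> F\<close> by (simp add: inj_on_eq_iff)
    qed
    moreover have "n * card F \<le> n * card ?M + card F"
    proof -
      have "A \<inter> ?X \<subseteq> \<nu> ` snd ` ?M"
      proof
        fix g assume g: "g \<in> A \<inter> ?X"
        then obtain a where "a \<in> A" "g = \<nu> x \<otimes>\<^bsub>G\<^esub> a" by (auto simp: l_coset_def)
        then obtain u where u: "u \<in> F" "g = \<nu> x \<otimes>\<^bsub>G\<^esub> \<nu> u" using F(2) by blast
        obtain v where v: "v \<in> F" "g = \<nu> v" using F(2) g by blast
        have "(u, v) \<in> ?M" using u v by simp
        then have "v \<in> snd ` ?M" by force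
        then show "g \<in> \<nu> ` snd ` ?M" using v by blast
      qed
      moreover have finM: "finite ?M" by (rule finite_subset[of _ "F \<times> F"]) (use finF in auto)
      ultimately have "card (A \<inter> ?X) \<le> card (\<nu> ` snd ` ?M)" by (intro card_mono) auto
      also have "\<dots> \<le> card ?M" using finM by (meson card_image_le finite_imageI order_trans)
      finally have 1: "card (A \<inter> ?X) \<le> card ?M" .
      have 2: "card A = card (A \<inter> ?X) + card (A - ?X)" using A'(1) by (rule card_Int_Diff)
      have "real (card (A - ?X)) / real (card A) \<le> 1 / real n"
        using A x unfolding Foelner_def by blast
      moreover have "card A > 0" using A' by (simp add: card_gt_0_iff)
      ultimately have "real n * real (card (A - ?X)) \<le> real (card A)"
        using n by (simp add: field_simps)
      then have "n * card (A - ?X) \<le> card A" by (metis of_nat_le_iff of_nat_mult)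
      moreover have "n * card A = n * card (A \<inter> ?X) + n * card (A - ?X)"
          by (subst 2) (rule distrib_left)
      moreover have "n * card (A \<inter> ?X) \<le> n * card ?M" by (rule mult_le_mono2[OF 1])
      ultimately have "n * card A \<le> n * card ?M + card A" by linarith
      moreover have "card F = card A" using F by (metis card_image)
      ultimately show ?thesis by simp
    qed
    ultimately show ?thesis by (intro exI[of _ ?M]) auto
  qed
  then have "almost_matched G \<nu> n D F"
    unfolding almost_matched_def using finF F(2) A'(2) by blast
  then show ?thesis using F(1) by blast
qed

lemma Foelner_if_level_condition:
  assumes "finite A" "A \<noteq> {}" "A \<subseteq> carrier G" "1 \<le> n"
    and "\<And>x. x \<in> D \<Longrightarrow> n * card (A - (x <#\<^bsub>G\<^esub> A)) \<le> card A"
  shows "A \<in> Foelner G D n"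
proof -
  have "real (card (A - (x <#\<^bsub>G\<^esub> A))) / real (card A) \<le> 1 / real n" if "x \<in> D" for x
  proof -
    have "real (n * card (A - (x <#\<^bsub>G\<^esub> A))) \<le> real (card A)" using assms(5)[OF that]
        by (simp only: of_nat_le_iff)
    moreover have "card A > 0" using assms by (simp add: card_gt_0_iff)
    ultimately show ?thesis using assms(4) by (simp add: field_simps)
  qed
  then show ?thesis unfolding Foelner_def using assms by blast
qed

text \<open>
  For \<open>t \<ge> 1\<close> these are the superlevel sets of the multiplicity function on the whole group.
\<close>

definition level_set :: "(nat \<Rightarrow> 'a) \<Rightarrow> nat set \<Rightarrow> nat \<Rightarrow> 'a set" where
  "level_set \<nu> F t = {g \<in> \<nu> ` F. t \<le> multiplicity_in \<nu> F g}"

text \<open>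
  Both sides count the pairs \<open>(t, g)\<close> for which \<open>t\<close> lies above the multiplicity at the translate
      of \<open>g\<close>
  and at or below the multiplicity at \<open>g\<close>.
\<close>

lemma sum_card_level_set_diff:
  assumes num: "numbered_group G \<nu>" and F: "finite F"
  shows "(\<Sum>t=1..card F. card (level_set \<nu> F t - (\<nu> x <#\<^bsub>G\<^esub> level_set \<nu> F t))) =
    (\<Sum>g\<in>\<nu> ` F. multiplicity_in \<nu> F g - multiplicity_in \<nu> F (inv\<^bsub>G\<^esub> (\<nu> x) \<otimes>\<^bsub>G\<^esub> g))"
proof -
  have G: "group G" and \<nu>: "\<nu> i \<in> carrier G" for i
    using num unfolding numbered_group_def by auto
  let ?m = "multiplicity_in \<nu> F" and ?m' = "\<lambda>g. multiplicity_in \<nu> F (inv\<^bsub>G\<^esub> (\<nu> x) \<otimes>\<^bsub>G\<^esub> g)"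
  have m_le: "?m g \<le> card F" for g
    unfolding multiplicity_in_def using F by (intro card_mono) auto
  have sub: "level_set \<nu> F t \<subseteq> carrier G" for t using \<nu> by (auto simp: level_set_def)
  have "level_set \<nu> F t - (\<nu> x <#\<^bsub>G\<^esub> level_set \<nu> F t) = {g \<in> \<nu> ` F. ?m' g < t \<and> t \<le> ?m g}"
    if t: "1 \<le> t" for t
  proof -
    have "h \<in> level_set \<nu> F t \<longleftrightarrow> t \<le> ?m h" for h
      using t multiplicity_in_eq_0[OF F, of \<nu> h] by (auto simp: level_set_def)
    then have "g \<in> \<nu> x <#\<^bsub>G\<^esub> level_set \<nu> F t \<longleftrightarrow> t \<le> ?m' g" if "g \<in> \<nu> ` F" for g
      using mem_l_coset_iff[OF G \<nu> _ sub] that \<nu> by blast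
    then show ?thesis by (auto simp: level_set_def not_le)
  qed
  then have "(\<Sum>t=1..card F. card (level_set \<nu> F t - (\<nu> x <#\<^bsub>G\<^esub> level_set \<nu> F t))) =
      (\<Sum>t=1..card F. card {g \<in> \<nu> ` F. ?m' g < t \<and> t \<le> ?m g})" by simp
  also have "\<dots> = (\<Sum>t=1..card F. \<Sum>g\<in>\<nu> ` F. if ?m' g < t \<and> t \<le> ?m g then 1 else 0)"
    using F by (simp add: sum.If_cases Int_def conj_commute)
  also have "\<dots> = (\<Sum>g\<in>\<nu> ` F. \<Sum>t=1..card F. if ?m' g < t \<and> t \<le> ?m g then 1 else 0)"
    by (rule sum.swap)
  also have "\<dots> = (\<Sum>g\<in>\<nu> ` F. ?m g - ?m' g)"
  proof (rule sum.cong[OF refl])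
    fix g
    have "(\<Sum>t=1..card F. if ?m' g < t \<and> t \<le> ?m g then 1 else 0) =
        card {t \<in> {1..card F}. ?m' g < t \<and> t \<le> ?m g}"
      by (simp add: sum.If_cases Int_def conj_commute)
    also have "{t \<in> {1..card F}. ?m' g < t \<and> t \<le> ?m g} = {?m' g<..?m g}"
      using m_le[of g] by auto
    finally show "(\<Sum>t=1..card F. if ?m' g < t \<and> t \<le> ?m g then 1 else 0) = ?m g - ?m' g" by simp
  qed
  finally show ?thesis .
qed

lemma sum_card_level_set:
  assumes F: "finite F"
  shows "(\<Sum>t=1..card F. card (level_set \<nu> F t)) = card F"
proof -
  let ?m = "multiplicity_in \<nu> F"
  have m_le: "?m g \<le> card F" for g
    unfolding multiplicity_in_def using F by (intro card_mono) auto
  have "(\<Sum>t=1..card F. card (level_set \<nu> F t)) = (\<Sum>t=1..card F. \<Sum>g\<in>\<nu> ` F. if t \<le> ?m g then 1 else 0)"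
    using F by (simp add: level_set_def sum.If_cases Int_def conj_commute)
  also have "\<dots> = (\<Sum>g\<in>\<nu> ` F. \<Sum>t=1..card F. if t \<le> ?m g then 1 else 0)" by (rule sum.swap)
  also have "\<dots> = (\<Sum>g\<in>\<nu> ` F. ?m g)"
  proof (rule sum.cong[OF refl])
    fix g
    have "(\<Sum>t=1..card F. if t \<le> ?m g then 1 else 0) = card {t \<in> {1..card F}. t \<le> ?m g}"
      by (simp add: sum.If_cases Int_def conj_commute)
    also have "{t \<in> {1..card F}. t \<le> ?m g} = {1..?m g}" using m_le[of g] by auto
    finally show "(\<Sum>t=1..card F. if t \<le> ?m g then 1 else 0) = ?m g" by simp
  qed
  also have "\<dots> = card F" by (rule sum_multiplicity_in[OF F])
  finally show ?thesis .
qed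

text \<open>
  If no nonempty superlevel set is a Foelner set, each of them fails at some \<open>x \<in> D\<close>. Summing the
  failures over all levels and over \<open>D\<close> bounds the total mass \<open>card F\<close> strictly by \<open>n\<close> times the
      total excess,
  while the matching with parameter \<open>n * k\<close> allows each of the at most \<open>k\<close> elements of \<open>D\<close> an
  excess of \<open>card F / (n * k)\<close> only.
\<close>

theorem Foelner_subset_if_matched:
  assumes num: "numbered_group G \<nu>" and n: "1 \<le> n" and D: "finite D" "card D \<le> k" "1 \<le> k"
    and A: "almost_matched G \<nu> (n * k) D F"
  shows "\<exists>F'\<subseteq>F. \<nu> ` F' \<in> Foelner G (\<nu> ` D) n"
proof (rule ccontr)
  assume none: "\<not> ?thesis"
  have \<nu>: "\<nu> i \<in> carrier G" for i using num unfolding numbered_group_def by auto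
  have F: "finite F" "F \<noteq> {}" using A unfolding almost_matched_def by auto
  then have N: "card F \<ge> 1" by (simp add: Suc_le_eq card_gt_0_iff)
  define L where "L = level_set \<nu> F"
  define d where "d t x = card (L t - (\<nu> x <#\<^bsub>G\<^esub> L t))" for t x
  have L_image: "L t = \<nu> ` {i \<in> F. \<nu> i \<in> L t}" for t by (auto simp: L_def level_set_def)
  have L: "finite (L t)" "L t \<subseteq> carrier G" for t using F \<nu> by (auto simp: L_def level_set_def)
  (* a nonempty level set is not a Foelner set and so fails at some x in D *)
  have bad: "card (L t) < n * (\<Sum>x\<in>D. d t x)" if ne: "L t \<noteq> {}" for t
  proof -
    have "\<nu> ` {i \<in> F. \<nu> i \<in> L t} \<notin> Foelner G (\<nu> ` D) n"
      using none[unfolded not_ex, rule_format, of "{i \<in> F. \<nu> i \<in> L t}"] by auto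
    then have "L t \<notin> Foelner G (\<nu> ` D) n" by (subst L_image)
    moreover have "L t \<in> Foelner G (\<nu> ` D) n" if "\<forall>x\<in>D. n * d t x \<le> card (L t)"
      using that by (intro Foelner_if_level_condition[OF L(1) ne L(2) n]) (auto simp: d_def)
    ultimately obtain x where x: "x \<in> D" "card (L t) < n * d t x" by (meson not_le)
    have "d t x \<le> (\<Sum>x\<in>D. d t x)" using D x by (intro member_le_sum) auto
    then have "n * d t x \<le> n * (\<Sum>x\<in>D. d t x)" by (rule mult_le_mono2)
    with x(2) show ?thesis by (rule less_le_trans)
  qed
  have "L 1 = \<nu> ` F"
    using multiplicity_in_eq_0[OF F(1), of \<nu>] by (force simp: L_def level_set_def Suc_le_eq)
  then have "L 1 \<noteq> {}" using F by simp
  then have "card (L 1) < n * (\<Sum>x\<in>D. d 1 x)" by (rule bad)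
  moreover have "card (L t) \<le> n * (\<Sum>x\<in>D. d t x)" for t
    using bad[of t] by (cases "L t = {}") auto
  ultimately have "(\<Sum>t=1..card F. card (L t)) < (\<Sum>t=1..card F. n * (\<Sum>x\<in>D. d t x))"
    using N by (intro sum_strict_mono_ex1) auto
  moreover have "(\<Sum>t=1..card F. card (L t)) = card F"
    unfolding L_def by (rule sum_card_level_set[OF F(1)])
  ultimately have "card F < n * (\<Sum>x\<in>D. \<Sum>t=1..card F. d t x)"
    by (simp add: sum_distrib_left[symmetric] sum.swap[of _ D])
  then have "k * card F < k * (n * (\<Sum>x\<in>D. \<Sum>t=1..card F. d t x))" using D(3) by simp
  also have "\<dots> = (\<Sum>x\<in>D. n * k * (\<Sum>t=1..card F. d t x))"
    by (simp add: sum_distrib_left ac_simps)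
  also have "\<dots> \<le> (\<Sum>x\<in>D. card F)"
    unfolding d_def L_def sum_card_level_set_diff[OF num F(1)]
    by (intro sum_mono excess_le_of_matched[OF num A])
  also have "\<dots> \<le> k * card F" using D(2) by simp
  finally show False by simp
qed

text \<open>
  If \<open>\<nu>\<close> is injective on \<open>F\<close>, the multiplicity function is an indicator function and its excess counts
  the elements which leave the translate.
\<close>

corollary Foelner_image_if_matched_inj:
  assumes num: "numbered_group G \<nu>" and n: "1 \<le> n"
    and A: "almost_matched G \<nu> n D F" and inj: "inj_on \<nu> F"
  shows "\<nu> ` F \<in> Foelner G (\<nu> ` D) n"
proof -
  have \<nu>: "\<nu> i \<in> carrier G" for i using num unfolding numbered_group_def by auto
  have G: "group G" using num unfolding numbered_group_def by auto
  have F: "finite F" "F \<noteq> {}" using A unfolding almost_matched_def by auto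
  have m: "multiplicity_in \<nu> F g = of_bool (g \<in> \<nu> ` F)" for g
  proof (cases "g \<in> \<nu> ` F")
    case True
    then obtain j where "j \<in> F" "g = \<nu> j" by blast
    then have "{i \<in> F. \<nu> i = g} = {j}" using inj by (auto dest: inj_onD)
    then show ?thesis using True by (simp add: multiplicity_in_def)
  next
    case False
    then show ?thesis using multiplicity_in_eq_0[OF F(1), of \<nu> g] by simp
  qed
  show ?thesis
  proof (rule Foelner_if_level_condition)
    fix g assume "g \<in> \<nu> ` D"
    then obtain x where x: "x \<in> D" "g = \<nu> x" by blast
    let ?X = "\<nu> x <#\<^bsub>G\<^esub> (\<nu> ` F)"
    have X: "h \<in> ?X \<longleftrightarrow> inv\<^bsub>G\<^esub> (\<nu> x) \<otimes>\<^bsub>G\<^esub> h \<in> \<nu> ` F" if "h \<in> \<nu> ` F" for h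
      using that \<nu> by (intro mem_l_coset_iff[OF G]) auto
    have "card (\<nu> ` F - ?X) = (\<Sum>h\<in>\<nu> ` F. if h \<in> ?X then 0 else 1)"
      using F(1) by (simp add: sum.If_cases set_diff_eq Int_def)
    also have "\<dots> = (\<Sum>h\<in>\<nu> ` F. multiplicity_in \<nu> F h - multiplicity_in \<nu> F (inv\<^bsub>G\<^esub> (\<nu> x) \<otimes>\<^bsub>G\<^esub> h))"
      by (rule sum.cong[OF refl]) (simp add: m X)
    finally show "n * card (\<nu> ` F - (g <#\<^bsub>G\<^esub> (\<nu> ` F))) \<le> card (\<nu> ` F)"
      using excess_le_of_matched[OF num A x(1)] inj by (simp add: x(2) card_image)
  qed (use F \<nu> n in auto)
qed

text \<open>
  A function and its translate have the same total mass, so their \<open>l\<^sup>1\<close> distance is twice the excess.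
  The parameter \<open>2 * n + 1\<close> accounts for this factor and for the strict inequality.
\<close>

theorem Reiter_ratio_if_matched:
  assumes num: "numbered_group G \<nu>" and n: "1 \<le> n"
    and A: "almost_matched G \<nu> (2 * n + 1) D F" and x: "x \<in> D"
  shows "l1_norm G (\<lambda>g. real (multiplicity_in \<nu> F g) - translate G (\<nu> x) (\<lambda>g. real
      (multiplicity_in \<nu> F g)) g)
    / l1_norm G (\<lambda>g. real (multiplicity_in \<nu> F g)) < 1 / real n"
proof -
  interpret group G using num unfolding numbered_group_def by blast
  have \<nu>: "\<nu> i \<in> carrier G" for i using num unfolding numbered_group_def by auto
  have F: "finite F" "F \<noteq> {}" using A unfolding almost_matched_def by auto
  let ?m = "\<lambda>g. multiplicity_in \<nu> F g" and ?y = "inv\<^bsub>G\<^esub> (\<nu> x)"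
  let ?m' = "\<lambda>g. multiplicity_in \<nu> F (?y \<otimes>\<^bsub>G\<^esub> g)"
  let ?X = "(\<lambda>g. \<nu> x \<otimes>\<^bsub>G\<^esub> g) ` \<nu> ` F"
  let ?T = "\<nu> ` F \<union> ?X"
  have T: "finite ?T" "?T \<subseteq> carrier G" using F \<nu> by auto
  have m0: "?m g = 0" if "g \<notin> \<nu> ` F" for g
    using that multiplicity_in_eq_0[OF F(1), of \<nu> g] by simp
  have m'0: "?m' g = 0" if "g \<in> carrier G" "g \<notin> ?X" for g
  proof (rule m0, rule)
    assume "?y \<otimes>\<^bsub>G\<^esub> g \<in> \<nu> ` F"
    then have "\<nu> x \<otimes>\<^bsub>G\<^esub> (?y \<otimes>\<^bsub>G\<^esub> g) \<in> ?X" by blast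
    moreover have "\<nu> x \<otimes>\<^bsub>G\<^esub> (?y \<otimes>\<^bsub>G\<^esub> g) = g" using \<nu> that(1) m_assoc[of "\<nu> x" ?y g] by simp
    ultimately show False using that(2) by simp
  qed
  define P where "P = (\<Sum>g\<in>\<nu> ` F. ?m g - ?m' g)"
  have P: "(2 * n + 1) * P \<le> card F" unfolding P_def by (rule excess_le_of_matched[OF num A x])
  have sum_m: "(\<Sum>g\<in>?T. ?m g) = card F"
    using sum_multiplicity_in[OF F(1), of \<nu>] T m0 sum.mono_neutral_left[of ?T "\<nu> ` F" ?m] by simp
  have "(\<Sum>g\<in>?T. ?m' g) = (\<Sum>g\<in>?X. ?m' g)"
    using T m'0 by (intro sum.mono_neutral_right) auto
  also have "\<dots> = (\<Sum>g\<in>\<nu> ` F. ?m' (\<nu> x \<otimes>\<^bsub>G\<^esub> g))"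
    using \<nu> by (subst sum.reindex) (auto simp: inj_on_def)
  also have "\<dots> = (\<Sum>g\<in>\<nu> ` F. ?m g)"
  proof (rule sum.cong[OF refl])
    fix g assume "g \<in> \<nu> ` F"
    then have "?y \<otimes>\<^bsub>G\<^esub> (\<nu> x \<otimes>\<^bsub>G\<^esub> g) = g" using \<nu> m_assoc[of ?y "\<nu> x" g] by auto
    then show "?m' (\<nu> x \<otimes>\<^bsub>G\<^esub> g) = ?m g" by simp
  qed
  also have "\<dots> = card F" by (rule sum_multiplicity_in[OF F(1)])
  finally have sum_m': "(\<Sum>g\<in>?T. ?m' g) = card F" .
  have "(\<Sum>g\<in>?T. ?m g - ?m' g) = P"
    unfolding P_def using T m0 by (intro sum.mono_neutral_right) auto
  (* the positive and the negative part of the difference have the same sum *)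
  moreover have "\<bar>real (?m g) - real (?m' g)\<bar> = 2 * real (?m g - ?m' g) - (real (?m g) - real (?m'
      g))" for g
    by (cases "?m' g \<le> ?m g") auto
  ultimately have "(\<Sum>g\<in>?T. \<bar>real (?m g) - real (?m' g)\<bar>) = 2 * real P"
    using sum_m sum_m' by (simp add: sum_subtractf sum_distrib_left[symmetric] flip: of_nat_sum)
  moreover have "l1_norm G (\<lambda>g. real (?m g) - translate G (\<nu> x) (\<lambda>g. real (?m g)) g) =
      (\<Sum>g\<in>?T. \<bar>real (?m g) - real (?m' g)\<bar>)"
    using T m0 m'0 by (subst l1_norm_eq_sum[of ?T]) (auto simp: translate_def)
  moreover have "l1_norm G (\<lambda>g. real (?m g)) = real (card F)"
    using T m0 sum_m by (subst l1_norm_eq_sum[of ?T]) (auto simp flip: of_nat_sum)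
  moreover have "2 * real P / real (card F) < 1 / real n"
  proof -
    have pos: "card F > 0" using F by (simp add: card_gt_0_iff)
    have "2 * n * P < card F"
    proof (cases "P = 0")
      case False
      then show ?thesis using P by (simp add: algebra_simps)
    qed (use pos in simp)
    then have "real (2 * n * P) < real (card F)" by (simp only: of_nat_less_iff)
    then show ?thesis using pos n by (simp add: field_simps)
  qed
  ultimately show ?thesis by simp
qed

section \<open>Codes of finite sets\<close>

text \<open>
  The triangular numbers in the pairing function are sums, so division is avoided.
\<close>

lemma computable_fn_prod_encode [computability_intros]:
  assumes "computable_fn k a" "computable_fn k b" shows "computable_fn k (\<lambda>xs. prod_encode (a xs,
      b xs))"
proof -
  have "triangle n = (\<Sum>i<n. Suc i)" for n by (induction n) simp_all
  then have "prod_encode (m, n) = (\<Sum>i<m + n. Suc i) + m" for m n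
    by (simp only: prod_encode_def prod.case)
  then show ?thesis using assms by (simp only:) (intro computability_intros; simp)
qed

text \<open>
  The binary digit of \<open>y\<close> at position \<open>x\<close> is described by a bounded search for the quotient and the
  remainder of division by a power of two.
\<close>

lemma decidable_mem_set_decode [computability_intros]:
  assumes "computable_fn k a" "computable_fn k b" shows "decidable k (\<lambda>xs. a xs \<in> set_decode (b xs))"
proof -
  have eq: "x \<in> set_decode y \<longleftrightarrow> (\<exists>q<Suc y. \<exists>r<2 ^ x. y = Suc (2 * q) * 2 ^ x + r)" for x y
  proof
    assume "x \<in> set_decode y"
    then obtain q where q: "y div 2 ^ x = 2 * q + 1" by (auto simp: set_decode_def elim: oddE)
    then have "y = Suc (2 * q) * 2 ^ x + y mod 2 ^ x"
      using div_mult_mod_eq[of y "2 ^ x"] by simp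
    moreover have "q < Suc y" using q div_le_dividend[of y "2 ^ x"] by linarith
    moreover have "y mod 2 ^ x < 2 ^ x" by simp
    ultimately show "\<exists>q<Suc y. \<exists>r<2 ^ x. y = Suc (2 * q) * 2 ^ x + r" by blast
  next
    assume "\<exists>q<Suc y. \<exists>r<2 ^ x. y = Suc (2 * q) * 2 ^ x + r"
    then obtain q r where "r < 2 ^ x" "y = Suc (2 * q) * 2 ^ x + r" by blast
    then have "y div 2 ^ x = Suc (2 * q)" by (metis div_mult_self3 div_less add.right_neutral
        power_not_zero zero_neq_numeral)
    then show "x \<in> set_decode y" by (simp add: set_decode_def)
  qed
  have "decidable 2 (\<lambda>xs. hd xs \<in> set_decode (hd (tl xs)))"
    unfolding eq by (intro computability_intros; simp)
  then show ?thesis using assms by (rule decidable_comp2)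
qed

lemma mem_set_decode_less: "i \<in> set_decode c \<Longrightarrow> i < c"
proof -
  assume "i \<in> set_decode c"
  then have "c div 2 ^ i \<noteq> 0" by (auto simp: set_decode_def intro: Nat.gr0I)
  then have "2 ^ i \<le> c" by (metis div_less not_le)
  then show "i < c" using less_exp[of i] by linarith
qed

lemma card_set_decode_eq_sum: "card (set_decode c) = (\<Sum>i<c. of_bool (i \<in> set_decode c))"
proof -
  have "{..<c} \<inter> {i. i \<in> set_decode c} = set_decode c" using mem_set_decode_less by auto
  then show ?thesis by simp
qed

lemma card_set_decode_le: "card (set_decode c) \<le> c"
  using card_mono[of "{..<c}" "set_decode c"] mem_set_decode_less by auto

lemma computable_fn_card_set_decode [computability_intros]: "computable_fn k a \<Longrightarrow>
    computable_fn k (\<lambda>xs. card (set_decode (a xs)))"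
proof (rule computable_fn_comp1[where f = "\<lambda>c. card (set_decode c)"])
  show "computable_fn 1 (\<lambda>xs. card (set_decode (hd xs)))"
    unfolding card_set_decode_eq_sum by (intro computability_intros; simp)
qed

section \<open>Semidecidability of the equality of a numbered group\<close>

lemma semidecidable_mem_ce_set:
  assumes A: "ce_set A" and a: "computable_fn k a" shows "semidecidable k (\<lambda>xs. a xs \<in> A)"
proof (cases "A = {}")
  case True
  then show ?thesis by (auto intro: semidecidable_if_decidable decidable_const)
next
  case False
  then obtain f where f: "computable_fn 1 (\<lambda>xs. f (hd xs))" "A = range f"
    using A unfolding ce_set_def computable1_iff by blast
  have "decidable (Suc k) (\<lambda>ys. a (tl ys) = f (hd ys))"
    by (rule decidable_eq[OF computable_fn_tl[OF a] computable_fn_comp1[OF f(1)]]) (rule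
        computable_fn_proj, simp)
  then show ?thesis by (rule semidecidableI) (auto simp: f(2))
qed

definition letter_code :: "nat \<Rightarrow> nat" where
  "letter_code i = word_code [Inl i]"

lemma letter_code_eq: "letter_code i = Suc (prod_encode (2 * i, 0))"
  by (simp add: letter_code_def word_code_def sum_encode_def)

lemma computable_fn_letter_code [computability_intros]: "computable_fn k a \<Longrightarrow>
    computable_fn k (\<lambda>xs. letter_code (a xs))"
  unfolding letter_code_eq by (intro computability_intros)

lemma inj_word_code: "inj word_code"
  unfolding word_code_def
  by (intro inj_compose[of list_encode "map sum_encode", unfolded comp_def])
     (auto intro: inj_list_encode inj_mapI inj_sum_encode)

lemma surj_word_code: "\<exists>w. c = word_code w"
proof -
  have "c = word_code (map sum_decode (list_decode c))"
    by (simp add: word_code_def comp_def)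
  then show ?thesis ..
qed

lemma mem_Wrd_eq_code_iff:
  "prod_encode (word_code w, word_code w') \<in> word_pair_code ` Wrd_eq G \<nu> \<longleftrightarrow>
     word_val G \<nu> w = word_val G \<nu> w'"
proof -
  have "inj word_pair_code"
    using inj_word_code by (auto simp: inj_def word_pair_code_def prod_eq_iff)
  then have "word_pair_code (w, w') \<in> word_pair_code ` Wrd_eq G \<nu> \<longleftrightarrow> (w, w') \<in> Wrd_eq G \<nu>"
    by (rule inj_image_mem_iff)
  then show ?thesis by (simp add: word_pair_code_def Wrd_eq_def)
qed

lemma word_val_letter:
  assumes "numbered_group G \<nu>" shows "word_val G \<nu> [Inl i] = \<nu> i"
proof -
  interpret group G using assms unfolding numbered_group_def by blast
  have "\<nu> i \<in> carrier G" using assms unfolding numbered_group_def by auto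
  then show ?thesis by (simp add: word_val_def)
qed

lemma word_val_closed:
  assumes "numbered_group G \<nu>" shows "word_val G \<nu> w \<in> carrier G"
proof (induction w)
  interpret group G using assms unfolding numbered_group_def by blast
  {
    case Nil
    show ?case by (simp add: word_val_def)
  next
    case (Cons l w)
    have "\<nu> i \<in> carrier G" for i using assms unfolding numbered_group_def by auto
    then have "letter_val G \<nu> l \<in> carrier G" by (cases l) auto
    then show ?case using Cons by (simp add: word_val_def)
  }
qed

text \<open>
  Equality of numbered elements is the restriction of the word problem to one-letter words, so it
  inherits enumerability and decidability from the word problem.
\<close>

lemma mem_Wrd_eq_letters_iff:
  assumes "numbered_group G \<nu>"
  shows "prod_encode (letter_code i, letter_code j) \<in> word_pair_code ` Wrd_eq G \<nu> \<longleftrightarrow> \<nu> i = \<nu> j"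
  unfolding letter_code_def mem_Wrd_eq_code_iff word_val_letter[OF assms] ..

lemma semidecidable_eq_numbered:
  assumes ce: "ce_numbered_group G \<nu>" and ab: "computable_fn k a" "computable_fn k b"
  shows "semidecidable k (\<lambda>xs. \<nu> (a xs) = \<nu> (b xs))"
proof -
  have num: "numbered_group G \<nu>" and W: "ce_set (word_pair_code ` Wrd_eq G \<nu>)"
    using ce unfolding ce_numbered_group_def by auto
  have "computable_fn k (\<lambda>xs. prod_encode (letter_code (a xs), letter_code (b xs)))"
    using ab by (intro computability_intros)
  from semidecidable_mem_ce_set[OF W this] show ?thesis unfolding mem_Wrd_eq_letters_iff[OF num] .
qed

lemma decidable_eq_numbered:
  assumes comp: "computable_numbered_group G \<nu>" and ab: "computable_fn k a" "computable_fn k b"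
  shows "decidable k (\<lambda>xs. \<nu> (a xs) = \<nu> (b xs))"
proof -
  have num: "numbered_group G \<nu>" and W: "computable_set (word_pair_code ` Wrd_eq G \<nu>)"
    using comp unfolding computable_numbered_group_def ce_numbered_group_def by auto
  have "computable_fn k (\<lambda>xs. prod_encode (letter_code (a xs), letter_code (b xs)))"
    using ab by (intro computability_intros)
  with W[unfolded computable_set_iff decidable_def] show ?thesis
    unfolding mem_Wrd_eq_letters_iff[OF num, symmetric] decidable_def by (rule computable_fn_comp1)
qed

section \<open>Computable search for matched sets\<close>

text \<open>
  Restricting both components to the set coded by \<open>c\<close> makes every number \<open>m\<close> the code of a pairing
  within that set, and quantifiers over pairs can be bounded by \<open>c\<close>.
\<close>

definition paired :: "nat \<Rightarrow> nat \<Rightarrow> nat \<Rightarrow> nat \<Rightarrow> bool" where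
  "paired c m u v \<longleftrightarrow> u \<in> set_decode c \<and> v \<in> set_decode c \<and> prod_encode (u, v) \<in> set_decode m"

lemma decidable_paired [computability_intros]:
  "computable_fn k c \<Longrightarrow> computable_fn k m \<Longrightarrow> computable_fn k u \<Longrightarrow> computable_fn k v \<Longrightarrow>
      decidable k (\<lambda>xs. paired (c xs) (m xs) (u xs) (v xs))"
  unfolding paired_def by (intro computability_intros)

definition injective_pairing :: "nat \<Rightarrow> nat \<Rightarrow> bool" where
  "injective_pairing c m \<longleftrightarrow> (\<forall>u<c. \<forall>v<c. \<forall>u'<c. \<forall>v'<c.
     paired c m u v \<and> paired c m u' v' \<longrightarrow> (u = u' \<longleftrightarrow> v = v'))"

lemma decidable_injective_pairing [computability_intros]:
  "computable_fn k c \<Longrightarrow> computable_fn k m \<Longrightarrow> decidable k (\<lambda>xs. injective_pairing (c xs) (m xs))"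
proof (rule decidable_comp2[where P = injective_pairing])
  show "decidable 2 (\<lambda>xs. injective_pairing (hd xs) (hd (tl xs)))"
    unfolding injective_pairing_def by (intro computability_intros; simp)
qed

definition pairing_size :: "nat \<Rightarrow> nat \<Rightarrow> nat" where
  "pairing_size c m = (\<Sum>u<c. \<Sum>v<c. of_bool (paired c m u v))"

lemma computable_fn_pairing_size [computability_intros]:
  "computable_fn k c \<Longrightarrow> computable_fn k m \<Longrightarrow> computable_fn k (\<lambda>xs. pairing_size (c xs) (m xs))"
proof (rule computable_fn_comp2[where f = pairing_size])
  show "computable_fn 2 (\<lambda>xs. pairing_size (hd xs) (hd (tl xs)))"
    unfolding pairing_size_def by (intro computability_intros; simp)
qed

lemma paired_less: "paired c m u v \<Longrightarrow> u < c \<and> v < c"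
  unfolding paired_def using mem_set_decode_less by blast

lemma pairing_size_eq: "pairing_size c m = card {(u, v). paired c m u v}"
proof -
  have "pairing_size c m = (\<Sum>p\<in>{..<c} \<times> {..<c}. of_bool (paired c m (fst p) (snd p)))"
    by (simp add: pairing_size_def sum.cartesian_product split_def del: sum_of_bool_eq)
  also have "\<dots> = card ({..<c} \<times> {..<c} \<inter> {p. paired c m (fst p) (snd p)})" by simp
  also have "{..<c} \<times> {..<c} \<inter> {p. paired c m (fst p) (snd p)} = {(u, v). paired c m u v}"
    using paired_less by auto
  finally show ?thesis .
qed

lemma injective_pairing_iff:
  "injective_pairing c m \<longleftrightarrow> inj_on fst {(u, v). paired c m u v} \<and> inj_on snd {(u, v). paired c m u v}"
proof -
  have "injective_pairing c m \<longleftrightarrow>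
      (\<forall>u v u' v'. paired c m u v \<and> paired c m u' v' \<longrightarrow> (u = u' \<longleftrightarrow> v = v'))"
    unfolding injective_pairing_def using paired_less by blast
  then show ?thesis by (auto simp: inj_on_def)
qed

lemma pairing_code_exists:
  assumes "M \<subseteq> set_decode c \<times> set_decode c"
  shows "\<exists>m. {(u, v). paired c m u v} = M"
proof -
  have "finite M" by (rule finite_subset[OF assms]) simp
  then have "set_decode (set_encode (prod_encode ` M)) = prod_encode ` M" by simp
  then have "{(u, v). paired c (set_encode (prod_encode ` M)) u v} = M"
    using assms by (auto simp: paired_def)
  then show ?thesis ..
qed

text \<open>
  This arithmetical form of \<open>almost_matched\<close> has only bounded quantifiers apart from the one over the
  matching \<open>m\<close>, and equality in the group occurs positively.
\<close>

definition certified ::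
    "(nat \<Rightarrow> 'a) \<Rightarrow> (nat \<Rightarrow> nat \<Rightarrow> nat) \<Rightarrow> nat \<Rightarrow> nat \<Rightarrow> nat \<Rightarrow> bool" where
  "certified \<nu> mul n d c \<longleftrightarrow> c \<noteq> 0 \<and>
     (\<forall>x<d. x \<in> set_decode d \<longrightarrow> (\<exists>m. (injective_pairing c m \<and>
        n * card (set_decode c) \<le> n * pairing_size c m + card (set_decode c)) \<and>
        (\<forall>u<c. \<forall>v<c. paired c m u v \<longrightarrow> \<nu> (mul x u) = \<nu> v)))"

text \<open>
  Finite sets of pairs within the set coded by \<open>c\<close> are exactly the decoded pairings.
\<close>

lemma certified_iff:
  assumes mul: "\<And>i j. \<nu> (mul i j) = \<nu> i \<otimes>\<^bsub>G\<^esub> \<nu> j"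
  shows "certified \<nu> mul n d c \<longleftrightarrow> almost_matched G \<nu> n (set_decode d) (set_decode c)"
proof -
  have *: "(\<exists>m. (injective_pairing c m \<and>
        n * card (set_decode c) \<le> n * pairing_size c m + card (set_decode c)) \<and>
        (\<forall>u<c. \<forall>v<c. paired c m u v \<longrightarrow> \<nu> (mul x u) = \<nu> v)) \<longleftrightarrow>
      (\<exists>M. M \<subseteq> set_decode c \<times> set_decode c \<and> inj_on fst M \<and> inj_on snd M \<and>
        (\<forall>(u, v)\<in>M. \<nu> x \<otimes>\<^bsub>G\<^esub> \<nu> u = \<nu> v) \<and>
        n * card (set_decode c) \<le> n * card M + card (set_decode c))" (is "?L \<longleftrightarrow> ?R") for x
  proof
    assume ?L
    then obtain m where m: "injective_pairing c m"
        "n * card (set_decode c) \<le> n * pairing_size c m + card (set_decode c)"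
        "\<forall>u<c. \<forall>v<c. paired c m u v \<longrightarrow> \<nu> (mul x u) = \<nu> v" by blast
    have "\<nu> x \<otimes>\<^bsub>G\<^esub> \<nu> u = \<nu> v" if "paired c m u v" for u v
      using m(3) paired_less[OF that] that mul by simp
    then show ?R
      using m(1,2) by (intro exI[of _ "{(u, v). paired c m u v}"])
        (auto simp: injective_pairing_iff pairing_size_eq paired_def)
  next
    assume ?R
    then obtain M where M: "M \<subseteq> set_decode c \<times> set_decode c" "inj_on fst M" "inj_on snd M"
        "\<forall>(u, v)\<in>M. \<nu> x \<otimes>\<^bsub>G\<^esub> \<nu> u = \<nu> v"
        "n * card (set_decode c) \<le> n * card M + card (set_decode c)" by blast
    obtain m where m: "{(u, v). paired c m u v} = M" using pairing_code_exists[OF M(1)] by blast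
    have "\<nu> (mul x u) = \<nu> v" if "paired c m u v" for u v
      using M(4) that unfolding m[symmetric] by (auto simp: mul)
    then show ?L
      using M(2,3,5) by (intro exI[of _ m]) (simp add: injective_pairing_iff pairing_size_eq m)
  qed
  have "c \<noteq> 0 \<longleftrightarrow> set_decode c \<noteq> {}"
    by (metis set_decode_inverse set_decode_zero)
  then show ?thesis
    unfolding certified_def almost_matched_def * using mem_set_decode_less by auto
qed

lemma semidecidable_certified:
  assumes ce: "ce_numbered_group G \<nu>" and mul: "computable2 mul"
  shows "semidecidable 3 (\<lambda>xs. certified \<nu> mul (hd (tl xs)) (hd (tl (tl xs))) (hd xs))"
  unfolding certified_def
  by (intro semidecidable_conj semidecidable_if_decidable[OF decidable_not] semidecidable_ball
      semidecidable_imp semidecidable_ex semidecidable_if_decidable[OF decidable_conj]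
      semidecidable_eq_numbered[OF ce] computable_fn_comp2[OF mul[unfolded computable2_iff]]
          computability_intros; simp)

text \<open>
  The side condition \<open>Q\<close> is trivial in the general case and expresses injectivity of \<open>\<nu>\<close> on the set
  when the word problem is decidable.
\<close>

theorem computable_search_almost_matched:
  assumes ce: "ce_numbered_group G \<nu>" and Q: "decidable 1 (\<lambda>xs. Q (hd xs))"
    and ex: "\<And>n D. finite D \<Longrightarrow> \<exists>F. almost_matched G \<nu> n D F \<and> Q (set_encode F)"
  shows "\<exists>f. computable2 f \<and>
    (\<forall>n d. almost_matched G \<nu> n (set_decode d) (set_decode (f n d)) \<and> Q (f n d))"
proof -
  obtain N where N: "computable2 (\<lambda>m n. m \<otimes>\<^bsub>N\<^esub> n)" "\<nu> \<in> epi N G" "enumerated_group N"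
    using ce unfolding ce_numbered_group_def by blast
  let ?mul = "\<lambda>m n. m \<otimes>\<^bsub>N\<^esub> n"
  have mul: "\<nu> (i \<otimes>\<^bsub>N\<^esub> j) = \<nu> i \<otimes>\<^bsub>G\<^esub> \<nu> j" for i j
    using N(2,3) unfolding epi_def hom_def enumerated_group_def by auto
  let ?P = "\<lambda>c xs. certified \<nu> ?mul (hd xs) (hd (tl xs)) c \<and> Q c"
  have "semidecidable (Suc 2) (\<lambda>ys. ?P (hd ys) (tl ys))"
    using semidecidable_certified[OF ce N(1)]
    by (intro semidecidable_conj semidecidable_if_decidable[OF computable_fn_comp1[OF Q[unfolded
        decidable_def], folded decidable_def]] computable_fn_proj)
       (simp_all add: numeral_3_eq_3 numeral_2_eq_2)
  moreover have "\<exists>c. ?P c xs" for xs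
  proof -
    obtain F where F: "almost_matched G \<nu> (hd xs) (set_decode (hd (tl xs))) F" "Q (set_encode F)"
      using ex[of "set_decode (hd (tl xs))" "hd xs"] by auto
    then have "set_decode (set_encode F) = F" by (simp add: almost_matched_def)
    then show ?thesis using F certified_iff[of \<nu> ?mul G, OF mul] by (metis (mono_tags))
  qed
  ultimately obtain f where f: "computable_fn 2 f" "\<And>xs. length xs = 2 \<Longrightarrow> ?P (f xs) xs"
    using semidecidable_uniformization[of 2 ?P] by blast
  have "computable_fn 2 (\<lambda>xs. f [hd xs, hd (tl xs)])"
    using f(1) by (rule computable_fn_cong) (auto simp: numeral_2_eq_2 length_Suc_conv)
  then have "computable2 (\<lambda>n d. f [n, d])" by (simp add: computable2_iff)
  moreover have "almost_matched G \<nu> n (set_decode d) (set_decode (f [n, d])) \<and> Q (f [n, d])" for n d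
    using f(2)[of "[n, d]"] certified_iff[of \<nu> ?mul G, OF mul] by simp
  ultimately show ?thesis by blast
qed

section \<open>Amenable groups admit computable Reiter functions and Foelner sets\<close>

text \<open>
  The list of values is built from its end; \<open>2\<close> codes the rational number \<open>1\<close> and \<open>0\<close> codes \<open>0\<close>.
\<close>

definition indicator_code :: "nat \<Rightarrow> nat" where
  "indicator_code c =
     rec_nat 0 (\<lambda>i r. Suc (prod_encode (2 * of_bool (c - Suc i \<in> set_decode c), r))) c"

lemma computable_fn_indicator_code: "computable_fn k a \<Longrightarrow> computable_fn k (\<lambda>xs. indicator_code (a xs))"
proof (rule computable_fn_comp1[where f = indicator_code])
  show "computable_fn 1 (\<lambda>xs. indicator_code (hd xs))"
    unfolding indicator_code_def by (intro computability_intros; simp)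
qed

lemma list_decode_indicator_code:
  "list_decode (indicator_code c) = map (\<lambda>i. 2 * of_bool (i \<in> set_decode c)) [0..<c]"
proof -
  have "rec_nat 0 (\<lambda>i r. Suc (prod_encode (2 * of_bool (c - Suc i \<in> set_decode c), r))) j =
      list_encode (map (\<lambda>i. 2 * of_bool (i \<in> set_decode c)) [c - j..<c])" if "j \<le> c" for j
    using that
  proof (induction j)
    case (Suc j)
    then have "[c - Suc j..<c] = (c - Suc j) # [c - j..<c]"
      by (simp add: upt_conv_Cons Suc_diff_Suc)
    then show ?case using Suc by simp
  qed simp
  from this[of c] show ?thesis by (simp add: indicator_code_def)
qed

lemma nonneg_rat_of_bool: "nonneg_rat_of (2 * of_bool b) = of_bool b"
proof -
  have "prod_encode (0, 0) = 0" "prod_encode (1, 0) = 2"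
    by (simp_all add: prod_encode_def triangle_def)
  then have "prod_decode 0 = (0, 0)" "prod_decode 2 = (1, 0)"
    using prod_encode_inverse[of "(0, 0)"] prod_encode_inverse[of "(1, 0)"] by simp_all
  then show ?thesis by (cases b) (simp_all add: nonneg_rat_of_def)
qed

lemma fin_fun_of_indicator_code: "fin_fun_of (indicator_code c) i = of_bool (i \<in> set_decode c)"
  using mem_set_decode_less[of i c]
  by (auto simp: fin_fun_of_def list_decode_indicator_code nonneg_rat_of_bool)

lemma pushforward_indicator:
  "pushforward \<nu> (\<lambda>i. real_of_rat (fin_fun_of (indicator_code c) i)) =
     (\<lambda>g. real (multiplicity_in \<nu> (set_decode c) g))"
proof
  fix g
  have "pushforward \<nu> (\<lambda>i. of_bool (i \<in> set_decode c) :: real) g =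
      (\<Sum>i | (of_bool (i \<in> set_decode c) :: real) \<noteq> 0 \<and> \<nu> i = g. of_bool (i \<in> set_decode c))"
    by (rule pushforward_eq_sum) simp
  also have "\<dots> = real (multiplicity_in \<nu> (set_decode c) g)"
    by (simp add: multiplicity_in_def)
  finally show "pushforward \<nu> (\<lambda>i. real_of_rat (fin_fun_of (indicator_code c) i)) g =
      real (multiplicity_in \<nu> (set_decode c) g)"
    by (simp add: fin_fun_of_indicator_code of_bool_def if_distrib[of real_of_rat] cong: if_cong)
qed

lemma almost_matched_0: "almost_matched G \<nu> 0 D {0}"
  unfolding almost_matched_def by (auto intro!: exI[of _ "{}"])

lemma injective_almost_matched_exists:
  assumes num: "numbered_group G \<nu>" and am: "amenable G" and D: "finite D"
  shows "\<exists>F. almost_matched G \<nu> n D F \<and> inj_on \<nu> F"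
proof (cases "n = 0")
  case True
  then show ?thesis using almost_matched_0 by (intro exI[of _ "{0}"]) auto
next
  case False
  have G: "group G" and "\<nu> ` D \<subseteq> carrier G"
    using num unfolding numbered_group_def by auto
  then obtain A where "A \<in> Foelner G (\<nu> ` D) n"
    using Foelner_nonempty_if_amenable[OF G am, of "\<nu> ` D" n] D False by auto
  then show ?thesis using Foelner_lift_matched[OF num] False by simp
qed

lemma almost_matched_computable_if_amenable:
  assumes ce: "ce_numbered_group G \<nu>" and am: "amenable G"
  shows "\<exists>f. computable2 f \<and> (\<forall>n d. almost_matched G \<nu> n (set_decode d) (set_decode (f n d)))"
proof -
  have num: "numbered_group G \<nu>" using ce unfolding ce_numbered_group_def by blast
  show ?thesis
    using computable_search_almost_matched[OF ce decidable_const[of 1 True]]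
      injective_almost_matched_exists[OF num am] by blast
qed

theorem computable_Reiter_if_amenable:
  assumes ce: "ce_numbered_group G \<nu>" and am: "amenable G"
  shows "computable_Reiter G \<nu>"
proof -
  have num: "numbered_group G \<nu>" using ce unfolding ce_numbered_group_def by blast
  obtain f where f: "computable2 f" and
    m: "\<And>n d. almost_matched G \<nu> n (set_decode d) (set_decode (f n d))"
    using almost_matched_computable_if_amenable[OF assms] by blast
  have "computable2 (\<lambda>n d. indicator_code (f (2 * n + 1) d))"
    unfolding computable2_iff
    by (intro computable_fn_indicator_code computable_fn_comp2[OF f[unfolded computable2_iff]]
        computability_intros; simp)
  moreover have "let r = fin_fun_of (indicator_code (f (2 * n + 1) (set_encode D)));
        h = pushforward \<nu> (\<lambda>i. real_of_rat (r i))
      in (\<exists>i. r i \<noteq> 0) \<and>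
         (\<forall>x\<in>D. l1_norm G (\<lambda>g. h g - translate G (\<nu> x) h g) / l1_norm G h < 1 / real n)"
    if n: "1 \<le> n" and D: "finite D" for n D
  proof -
    have A: "almost_matched G \<nu> (2 * n + 1) D (set_decode (f (2 * n + 1) (set_encode D)))"
      using m[of "2 * n + 1" "set_encode D"] D by simp
    then obtain i where "i \<in> set_decode (f (2 * n + 1) (set_encode D))"
      unfolding almost_matched_def by blast
    then have "\<exists>i. fin_fun_of (indicator_code (f (2 * n + 1) (set_encode D))) i \<noteq> 0"
      by (intro exI[of _ i]) (simp add: fin_fun_of_indicator_code)
    moreover note Reiter_ratio_if_matched[OF num n A]
    ultimately show ?thesis unfolding Let_def pushforward_indicator by blast
  qed
  ultimately show ?thesis unfolding computable_Reiter_def by blast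
qed

text \<open>
  The number of elements of \<open>D\<close> is at most the code of \<open>D\<close>, which is at hand as an argument of the
  algorithm and serves as the factor in the precision of the search.
\<close>

theorem Sigma_amenable_if_amenable:
  assumes ce: "ce_numbered_group G \<nu>" and am: "amenable G"
  shows "Sigma_amenable G \<nu>"
proof -
  have num: "numbered_group G \<nu>" using ce unfolding ce_numbered_group_def by blast
  obtain f where f: "computable2 f" and
    m: "\<And>n d. almost_matched G \<nu> n (set_decode d) (set_decode (f n d))"
    using almost_matched_computable_if_amenable[OF assms] by blast
  have "computable2 (\<lambda>n d. f (n * Suc d) d)"
    unfolding computable2_iff
    by (intro computable_fn_comp2[OF f[unfolded computable2_iff]] computability_intros; simp)
  moreover have "\<exists>F'. F' \<subseteq> set_decode (f (n * Suc (set_encode D)) (set_encode D)) \<and>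
      \<nu> ` F' \<in> Foelner G (\<nu> ` D) n" if n: "1 \<le> n" and D: "finite D" for n D
  proof (rule Foelner_subset_if_matched[OF num n D])
    show "card D \<le> Suc (set_encode D)"
      using card_set_decode_le[of "set_encode D"] D by simp
    show "almost_matched G \<nu> (n * Suc (set_encode D)) D
        (set_decode (f (n * Suc (set_encode D)) (set_encode D)))"
      using m[of "n * Suc (set_encode D)" "set_encode D"] D by simp
  qed simp
  ultimately show ?thesis unfolding Sigma_amenable_def by blast
qed

theorem subrecursive_Foelner_if_Sigma_amenable:
  assumes "Sigma_amenable G \<nu>" shows "subrecursive_Foelner G \<nu>"
proof -
  obtain a where a: "computable2 a"
    "\<And>n D. 1 \<le> n \<Longrightarrow> finite D \<Longrightarrow>
       \<exists>F'. F' \<subseteq> set_decode (a n (set_encode D)) \<and> \<nu> ` F' \<in> Foelner G (\<nu> ` D) n"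
    using assms unfolding Sigma_amenable_def by blast
  have "Foelner_fun G \<nu> n D \<le> enat (a n (set_encode D))" if nD: "1 \<le> n" "finite D" for n D
  proof -
    obtain F' where F': "F' \<subseteq> set_decode (a n (set_encode D))" "\<nu> ` F' \<in> Foelner G (\<nu> ` D) n"
      using a(2)[OF nD] by blast
    have "finite F'" using F'(1) by (rule finite_subset) simp
    then have "card (\<nu> ` F') \<le> card F'" by (rule card_image_le)
    also have "\<dots> \<le> card (set_decode (a n (set_encode D)))" using F'(1) by (intro card_mono) simp_all
    also have "\<dots> \<le> a n (set_encode D)" by (rule card_set_decode_le)
    finally show ?thesis unfolding Foelner_fun_def using F'(2) by (intro INF_lower2) simp_all
  qed
  then show ?thesis unfolding subrecursive_Foelner_def using a(1) by blast
qed

lemma Foelner_nonempty_if_subrecursive: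
  assumes "subrecursive_Foelner G \<nu>" "1 \<le> n" "finite D"
  shows "Foelner G (\<nu> ` D) n \<noteq> {}"
proof
  obtain b where "Foelner_fun G \<nu> n D \<le> enat (b n (set_encode D))"
    using assms unfolding subrecursive_Foelner_def by blast
  moreover assume "Foelner G (\<nu> ` D) n = {}"
  ultimately show False by (simp add: Foelner_fun_def top_enat_def)
qed

text \<open>
  A lifted Foelner set is almost matched, so the estimate for Reiter functions provides almost
  invariant densities.
\<close>

theorem amenable_if_Foelner_nonempty:
  assumes num: "numbered_group G \<nu>" and ex: "\<And>n D. 1 \<le> n \<Longrightarrow> finite D \<Longrightarrow> Foelner G (\<nu> ` D) n \<noteq> {}"
  shows "amenable G"
proof -
  have G: "group G" and \<nu>: "range \<nu> = carrier G" using num unfolding numbered_group_def by auto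
  have "\<exists>F. almost_matched G \<nu> (2 * Suc n + 1) {..n} F" for n
    using ex[of "2 * Suc n + 1" "{..n}"] Foelner_lift_matched[OF num, of "2 * Suc n + 1" _
        "{..n}"] by auto
  then obtain F where F: "\<And>n. almost_matched G \<nu> (2 * Suc n + 1) {..n} (F n)" by metis
  then have fin: "finite (F n)" and ne: "F n \<noteq> {}" for n unfolding almost_matched_def by auto
  let ?h = "\<lambda>n g. real (multiplicity_in \<nu> (F n) g)"
  show ?thesis
  proof (rule amenable_if_densities[OF G, of "\<lambda>n. \<nu> ` F n" ?h])
    show "?h n g = 0" if "g \<notin> \<nu> ` F n" for n g using that multiplicity_in_eq_0[OF fin, of \<nu> n g]
        by simp
    show "\<exists>g. ?h n g \<noteq> 0" for n
      using ne[of n] multiplicity_in_eq_0[OF fin, of \<nu> n] by fastforce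
    fix x assume "x \<in> carrier G"
    then obtain j where j: "x = \<nu> j" using \<nu> by auto
    show "(\<lambda>n. l1_norm G (\<lambda>g. ?h n g - translate G x (?h n) g) / l1_norm G (?h n)) \<longlonglongrightarrow> 0"
    proof (rule l1_ratio_tendsto_0)
      show "l1_norm G (\<lambda>g. ?h n g - translate G x (?h n) g) / l1_norm G (?h n) < 1 / real (Suc n)"
        if "j \<le> n" for n
        unfolding j using that by (intro Reiter_ratio_if_matched[OF num _ F]) auto
    qed
  qed (use fin \<nu> in auto)
qed

section \<open>Computable amenability and the word problem\<close>

theorem computably_amenable_if_computable:
  assumes comp: "computable_numbered_group G \<nu>" and am: "amenable G"
  shows "computably_amenable G \<nu>"
proof -
  have ce: "ce_numbered_group G \<nu>" using comp unfolding computable_numbered_group_def by blast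
  then have num: "numbered_group G \<nu>" unfolding ce_numbered_group_def by blast
  let ?Q = "\<lambda>c. \<forall>i<c. \<forall>j<c. i \<in> set_decode c \<and> j \<in> set_decode c \<and> \<nu> i = \<nu> j \<longrightarrow> i = j"
  have Q: "?Q c \<longleftrightarrow> inj_on \<nu> (set_decode c)" for c
    using mem_set_decode_less unfolding inj_on_def by blast
  have "decidable 1 (\<lambda>xs. ?Q (hd xs))"
    by (intro computability_intros decidable_eq_numbered[OF comp]; simp)
  moreover have "\<exists>F. almost_matched G \<nu> n D F \<and> ?Q (set_encode F)" if D: "finite D" for n D
  proof -
    obtain F where F: "almost_matched G \<nu> n D F" "inj_on \<nu> F"
      using injective_almost_matched_exists[OF num am D] by blast
    then have "set_decode (set_encode F) = F" by (simp add: almost_matched_def)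
    then show ?thesis using F unfolding Q by auto
  qed
  ultimately obtain f where f: "computable2 f"
    "\<And>n d. almost_matched G \<nu> n (set_decode d) (set_decode (f n d)) \<and> ?Q (f n d)"
    using computable_search_almost_matched[OF ce, of ?Q] by blast
  have "let F = set_decode (f n (set_encode D))
      in \<nu> ` F \<in> Foelner G (\<nu> ` D) n \<and> card F = card (\<nu> ` F)" if n: "1 \<le> n" and D: "finite D" for n D
  proof -
    have A: "almost_matched G \<nu> n D (set_decode (f n (set_encode D)))"
      and inj: "inj_on \<nu> (set_decode (f n (set_encode D)))"
      using f(2)[of n "set_encode D"] D Q by auto
    from Foelner_image_if_matched_inj[OF num n A inj] card_image[OF inj] show ?thesis
      unfolding Let_def by simp
  qed
  then show ?thesis unfolding computably_amenable_def using f(1) by blast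
qed

lemma Sigma_amenable_if_computably_amenable:
  assumes "computably_amenable G \<nu>" shows "Sigma_amenable G \<nu>"
  using assms unfolding computably_amenable_def Sigma_amenable_def Let_def by blast

lemma translate_meets_Foelner:
  assumes num: "numbered_group G \<nu>" and F: "\<nu> ` F \<in> Foelner G {\<nu> z} 2"
  shows "\<exists>u\<in>F. \<exists>v\<in>F. \<nu> z \<otimes>\<^bsub>G\<^esub> \<nu> u = \<nu> v"
proof -
  let ?A = "\<nu> ` F"
  have A: "finite ?A" "?A \<noteq> {}" "real (card (?A - (\<nu> z <#\<^bsub>G\<^esub> ?A))) / real (card ?A) \<le> 1 / 2"
    using F unfolding Foelner_def by auto
  have "?A \<inter> (\<nu> z <#\<^bsub>G\<^esub> ?A) \<noteq> {}"
  proof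
    assume "?A \<inter> (\<nu> z <#\<^bsub>G\<^esub> ?A) = {}"
    then have "?A - (\<nu> z <#\<^bsub>G\<^esub> ?A) = ?A" by blast
    then show False using A by simp
  qed
  then obtain g where g: "g \<in> ?A" "g \<in> \<nu> z <#\<^bsub>G\<^esub> ?A" by blast
  then obtain v where v: "v \<in> F" "g = \<nu> v" by blast
  obtain u where "u \<in> F" "g = \<nu> z \<otimes>\<^bsub>G\<^esub> \<nu> u" using g(2) unfolding l_coset_def by blast
  with v show ?thesis by metis
qed

text \<open>
  For words \<open>w\<close> and \<open>w'\<close>, numbers \<open>x\<close> and \<open>y\<close> of their values are found by search, which avoids
  evaluating the words letter by letter. The relation \<open>R r c\<close> collects everything that is searched
      for; it
  is semidecidable, every number \<open>c\<close> has an \<open>r\<close>, and every such \<open>r\<close> is the right answer to the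
  word problem for \<open>c\<close>.
\<close>

theorem computable_if_computably_amenable:
  assumes ce: "ce_numbered_group G \<nu>" and ca: "computably_amenable G \<nu>"
  shows "computable_numbered_group G \<nu>"
proof -
  have num: "numbered_group G \<nu>" and W: "ce_set (word_pair_code ` Wrd_eq G \<nu>)"
    using ce unfolding ce_numbered_group_def by auto
  interpret group G using num unfolding numbered_group_def by blast
  have \<nu>: "\<nu> i \<in> carrier G" for i using num unfolding numbered_group_def by auto
  let ?W = "word_pair_code ` Wrd_eq G \<nu>"
  obtain N where N: "enumerated_group N" "computable2 (\<lambda>m n. m \<otimes>\<^bsub>N\<^esub> n)" "computable1 (\<lambda>n. inv\<^bsub>N\<^esub> n)"
    "\<nu> \<in> epi N G"
    using ce unfolding ce_numbered_group_def by blast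
  have homN: "group_hom N G \<nu>"
    using N(1,4) unfolding epi_def enumerated_group_def
    by (auto intro!: group_hom.intro simp: group_hom_axioms_def is_group)
  have mul: "\<nu> (i \<otimes>\<^bsub>N\<^esub> j) = \<nu> i \<otimes>\<^bsub>G\<^esub> \<nu> j" and inv: "\<nu> (inv\<^bsub>N\<^esub> i) = inv\<^bsub>G\<^esub> (\<nu> i)" for i j
    using group_hom.hom_mult[OF homN, of i j] group_hom.hom_inv[OF homN, of i] N(1)
    unfolding enumerated_group_def by auto
  obtain a where a: "computable2 a" "\<And>z. (let F = set_decode (a 2 (2 ^ z))
      in \<nu> ` F \<in> Foelner G {\<nu> z} 2 \<and> card F = card (\<nu> ` F))"
  proof -
    obtain a where "computable2 a" "\<And>n D. 1 \<le> n \<Longrightarrow> finite D \<Longrightarrow> (let F = set_decode (a n (set_encode D))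
        in \<nu> ` F \<in> Foelner G (\<nu> ` D) n \<and> card F = card (\<nu> ` F))"
      using ca unfolding computably_amenable_def by blast
    from this(1) this(2)[of 2 "{z}" for z] show thesis
        by (intro that[of a]) (auto simp: set_encode_def)
  qed
  have F1: "\<nu> ` set_decode (a 2 (2 ^ z)) \<in> Foelner G {\<nu> z} 2" for z
    using a(2)[of z] by (simp add: Let_def)
  have F2: "inj_on \<nu> (set_decode (a 2 (2 ^ z)))" for z
    using a(2)[of z] by (intro eq_card_imp_inj_on) (simp_all add: Let_def)
  let ?z = "\<lambda>x y. x \<otimes>\<^bsub>N\<^esub> inv\<^bsub>N\<^esub> y"
  have z: "\<nu> (?z x y) = \<nu> x \<otimes>\<^bsub>G\<^esub> inv\<^bsub>G\<^esub> (\<nu> y)" for x y by (simp add: mul inv)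
  define R where "R r c \<longleftrightarrow> (\<exists>p q x y u v. c = prod_encode (p, q) \<and>
      prod_encode (letter_code x, p) \<in> ?W \<and> prod_encode (letter_code y, q) \<in> ?W \<and>
      (u \<in> set_decode (a 2 (2 ^ ?z x y)) \<and> v \<in> set_decode (a 2 (2 ^ ?z x y)) \<and>
       r = of_bool (u = v)) \<and> \<nu> (?z x y \<otimes>\<^bsub>N\<^esub> u) = \<nu> v)" for r c :: nat
  have R_correct: "r = of_bool (c \<in> ?W)" if R: "R r c" for r c
  proof -
    obtain p q x y u v where c: "c = prod_encode (p, q)"
      and W: "prod_encode (letter_code x, p) \<in> ?W" "prod_encode (letter_code y, q) \<in> ?W"
      and uv: "u \<in> set_decode (a 2 (2 ^ ?z x y))" "v \<in> set_decode (a 2 (2 ^ ?z x y))"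
      and r: "r = of_bool (u = v)" and eq: "\<nu> (?z x y \<otimes>\<^bsub>N\<^esub> u) = \<nu> v"
      using R unfolding R_def by blast
    obtain w w' where w: "p = word_code w" "q = word_code w'" using surj_word_code by metis
    have val: "\<nu> x = word_val G \<nu> w" "\<nu> y = word_val G \<nu> w'"
      using W unfolding w letter_code_def mem_Wrd_eq_code_iff word_val_letter[OF num] by auto
    have "u = v \<longleftrightarrow> \<nu> u = \<nu> v" using F2[of "?z x y"] uv by (metis inj_onD)
    also have "\<dots> \<longleftrightarrow> \<nu> (?z x y) \<otimes>\<^bsub>G\<^esub> \<nu> u = \<nu> u" using eq by (auto simp: mul)
    also have "\<dots> \<longleftrightarrow> \<nu> (?z x y) = \<one>\<^bsub>G\<^esub>" using \<nu> by simp
    also have "\<dots> \<longleftrightarrow> \<nu> x = \<nu> y" unfolding z using \<nu>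
      by (metis inv_closed inv_inv inv_equality r_inv)
    also have "\<dots> \<longleftrightarrow> c \<in> ?W" unfolding c w mem_Wrd_eq_code_iff val ..
    finally show ?thesis using r by simp
  qed
  have R_total: "\<exists>r. R r c" for c
  proof -
    obtain p q where c: "c = prod_encode (p, q)" by (metis prod_decode_inverse surj_pair)
    obtain w w' where w: "p = word_code w" "q = word_code w'" using surj_word_code by metis
    have "word_val G \<nu> w \<in> range \<nu>" "word_val G \<nu> w' \<in> range \<nu>"
      using word_val_closed[OF num] num unfolding numbered_group_def by auto
    then obtain x y where xy: "word_val G \<nu> w = \<nu> x" "word_val G \<nu> w' = \<nu> y" by auto
    have W: "prod_encode (letter_code x, p) \<in> ?W" "prod_encode (letter_code y, q) \<in> ?W"
      unfolding w letter_code_def mem_Wrd_eq_code_iff word_val_letter[OF num] xy by simp_all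
    obtain u v where "u \<in> set_decode (a 2 (2 ^ ?z x y))" "v \<in> set_decode (a 2 (2 ^ ?z x y))"
      "\<nu> (?z x y) \<otimes>\<^bsub>G\<^esub> \<nu> u = \<nu> v"
      using translate_meets_Foelner[OF num F1] by blast
    then have "R (of_bool (u = v)) c" unfolding R_def using c W by (metis mul)
    then show ?thesis ..
  qed
  have "semidecidable (Suc 1) (\<lambda>ys. R (hd ys) (hd (tl ys)))"
    unfolding R_def
    by (intro semidecidable_ex semidecidable_conj semidecidable_if_decidable[OF decidable_eq]
        semidecidable_if_decidable[OF decidable_mem_set_decode] semidecidable_mem_ce_set[OF W]
        semidecidable_eq_numbered[OF ce] computability_intros computable_fn_comp2[OF N(2)[unfolded
            computable2_iff]]
        computable_fn_comp1[OF N(3)[unfolded computable1_iff]] computable_fn_comp2[OF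
            a(1)[unfolded computable2_iff]]) simp_all
  then have "\<exists>f. computable_fn 1 f \<and> (\<forall>xs. length xs = 1 \<longrightarrow> R (f xs) (hd xs))"
    by (rule semidecidable_uniformization) (rule R_total)
  then obtain f where f: "computable_fn 1 f" "\<And>xs. length xs = 1 \<Longrightarrow> R (f xs) (hd xs)" by blast
  have "decidable 1 (\<lambda>xs. hd xs \<in> ?W)"
    unfolding decidable_def by (rule computable_fn_cong[OF f(1)]) (rule R_correct[OF f(2), symmetric])
  then show ?thesis unfolding computable_numbered_group_def computable_set_iff using ce by blast
qed

theorem theorem1:
  fixes G :: "('a, 'b) monoid_scheme" and \<nu> :: "nat \<Rightarrow> 'a"
  assumes "ce_numbered_group G \<nu>"
  shows "(amenable G \<longleftrightarrow> computable_Reiter G \<nu>) \<and>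
         (amenable G \<longleftrightarrow> subrecursive_Foelner G \<nu>) \<and>
         (amenable G \<longleftrightarrow> Sigma_amenable G \<nu>) \<and>
         (computably_amenable G \<nu> \<longleftrightarrow> amenable G \<and> computable_numbered_group G \<nu>)"
proof -
  have num: "numbered_group G \<nu>" using assms unfolding ce_numbered_group_def by blast
  have sub: "amenable G" if "subrecursive_Foelner G \<nu>"
    using amenable_if_Foelner_nonempty[OF num Foelner_nonempty_if_subrecursive[OF that]] .
  show ?thesis
    using computable_Reiter_if_amenable[OF assms] amenable_if_computable_Reiter[OF num]
      Sigma_amenable_if_amenable[OF assms] subrecursive_Foelner_if_Sigma_amenable sub
      Sigma_amenable_if_computably_amenable computably_amenable_if_computable
      computable_if_computably_amenable[OF assms]
    by blast
qed

end
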